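(* Let $n\geq 7$ be odd. Then the directed Cayley graph $\mathcal{A}_n$ of the alternating group $A_n$ with generators $\tau_3,\tau_5,\ldots,\tau_n$ has a directed Hamiltonian cycle. Consequently $M_n=n!/2$.
   Context: $S_n$ is the symmetric group of permutations $\pi=[\pi(1),\ldots,\pi(n)]$ of $[n]=\{1,\ldots,n\}$, with composition $(\pi\rho)(i)=\pi(\rho(i))$. For $2\leq k\leq n$, $\tau_k:=[k,1,2,\ldots,k-1,k+1,\ldots,n]\in S_n$ (the permutation that jumps element $k$ to position $1$, shifting $1,\ldots,k-1$ right by one). For odd $k$, $\tau_k\in A_n$. The directed Cayley graph $\mathcal{A}_n$ has vertex set $A_n$ and a directed edge from $\pi$ to $\pi\tau_k$ for each $\pi\in A_n$ and each odd $k\in\{3,5,\ldots,n\}$. Similarly $\mathcal{S}_n$ is the directed Cayley graph of $S_n$ with generators $\tau_2,\ldots,\tau_n$. A cycle means a self-avoiding directed cycle. The Kendall tau distance $d(\pi,\sigma)$ is the inversion number of $\pi^{-1}\sigma$, i.e. the minimum number of elementary transpositions (swapping entries in positions $i,i+1$) needed to get from $\pi$ to $\sigma$. $M_n$ denotes the maximum length of a self-avoiding directed cycle in $\mathcal{S}_n$ containing no two permutations at Kendall tau distance $1$. *)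

theory Defs
  imports "HOL-Algebra.Sym_Groups" "Graph_Theory.Graph_Theory"
begin

definition cayley_digraph :: "('a, 'm) monoid_scheme \<Rightarrow> 'a set \<Rightarrow> ('a, 'a \<times> 'a) pre_digraph" where
  "cayley_digraph G S =
     \<lparr> verts = carrier G,
       arcs = {(x, x \<otimes>\<^bsub>G\<^esub> s) | x s. x \<in> carrier G \<and> s \<in> S},
       tail = fst, head = snd \<rparr>"

text \<open>In one-line notation \<open>tau k\<close> is \<open>[k, 1, 2, \<dots>, k - 1, k + 1, \<dots>, n]\<close>. Permutations of
  \<open>{1..n}\<close> fix all numbers outside \<open>{1..n}\<close>, so \<open>n\<close> is not a parameter.\<close>

definition tau :: "nat \<Rightarrow> nat \<Rightarrow> nat" where
  "tau k i = (if i = 1 then k else if 2 \<le> i \<and> i \<le> k then i - 1 else i)"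

definition sym_cayley :: "nat \<Rightarrow> (nat \<Rightarrow> nat, (nat \<Rightarrow> nat) \<times> (nat \<Rightarrow> nat)) pre_digraph" where
  "sym_cayley n = cayley_digraph (sym_group n) (tau ` {2..n})"

definition alt_cayley :: "nat \<Rightarrow> (nat \<Rightarrow> nat, (nat \<Rightarrow> nat) \<times> (nat \<Rightarrow> nat)) pre_digraph" where
  "alt_cayley n = cayley_digraph (alt_group n) (tau ` {k \<in> {3..n}. odd k})"

text \<open>A cycle is a list of arcs; each of its vertices is the tail of exactly one arc, so the
  length of the list is the number of vertices visited.\<close>

definition cycle_verts :: "('a, 'b) pre_digraph \<Rightarrow> 'b list \<Rightarrow> 'a set" where
  "cycle_verts G p = tail G ` set p"

definition hamiltonian_cycle :: "('a, 'b) pre_digraph \<Rightarrow> 'b list \<Rightarrow> bool" where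
  "hamiltonian_cycle G p \<longleftrightarrow> pre_digraph.cycle G p \<and> cycle_verts G p = verts G"

definition inversion_number :: "nat \<Rightarrow> (nat \<Rightarrow> nat) \<Rightarrow> nat" where
  "inversion_number n p = card {(i, j). 1 \<le> i \<and> i < j \<and> j \<le> n \<and> p i > p j}"

definition kendall_tau :: "nat \<Rightarrow> (nat \<Rightarrow> nat) \<Rightarrow> (nat \<Rightarrow> nat) \<Rightarrow> nat" where
  "kendall_tau n p q = inversion_number n (Hilbert_Choice.inv p \<circ> q)"

definition snake :: "nat \<Rightarrow> ((nat \<Rightarrow> nat) \<times> (nat \<Rightarrow> nat)) list \<Rightarrow> bool" where
  "snake n c \<longleftrightarrow> pre_digraph.cycle (sym_cayley n) c \<and>
     (\<forall>p \<in> cycle_verts (sym_cayley n) c. \<forall>q \<in> cycle_verts (sym_cayley n) c.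
        kendall_tau n p q \<noteq> 1)"

definition max_snake_length :: "nat \<Rightarrow> nat" where
  "max_snake_length n = Max {length c | c. snake n c}"

lemma tau_permutes:
  assumes "2 \<le> k" "k \<le> n"
  shows "tau k permutes {1..n}"
proof (rule bij_imp_permutes)
  have "inj_on (tau k) {1..n}"
    using assms by (auto simp: inj_on_def tau_def split: if_splits)
  moreover have "tau k ` {1..n} \<subseteq> {1..n}"
    using assms by (auto simp: tau_def split: if_splits)
  ultimately show "bij_betw (tau k) {1..n} {1..n}"
    by (simp add: bij_betw_def endo_inj_surj)
  show "tau k x = x" if "x \<notin> {1..n}" for x
    using that assms by (auto simp: tau_def)
qed

lemma tau_Suc:
  assumes "1 \<le> k"
  shows "tau (Suc k) = Transposition.transpose k (Suc k) \<circ> tau k"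
  using assms by (auto simp: fun_eq_iff tau_def Transposition.transpose_def)

lemma evenperm_tau:
  assumes "1 \<le> k"
  shows "evenperm (tau k) \<longleftrightarrow> odd k"
  using assms
proof (induction k rule: nat_induct_at_least)
  case base
  have "tau 1 = id" by (auto simp: fun_eq_iff tau_def)
  then show ?case by (simp add: evenperm_id)
next
  case (Suc k)
  have "permutation (tau k)"
  proof (cases "k = 1")
    case True
    then have "tau k = id" by (auto simp: fun_eq_iff tau_def)
    then show ?thesis by simp
  next
    case False
    then show ?thesis
      using Suc.hyps tau_permutes[of k k] permutation_permutes by (metis finite_atLeastAtMost
          le_antisym le_refl not_less_eq_eq numeral_2_eq_2 One_nat_def)
  qed
  then show ?case
    using Suc by (simp add: tau_Suc evenperm_comp permutation_swap_id evenperm_swap del: comp_apply o_apply)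
qed

lemma tau_in_sym_group: "2 \<le> k \<Longrightarrow> k \<le> n \<Longrightarrow> tau k \<in> carrier (sym_group n)"
  using tau_permutes[of k n] by (simp add: sym_group_def)

lemma tau_in_alt_group: "3 \<le> k \<Longrightarrow> k \<le> n \<Longrightarrow> odd k \<Longrightarrow> tau k \<in> carrier (alt_group n)"
  using tau_permutes[of k n] by (simp add: alt_group_def evenperm_tau)

lemma wf_cayley_digraph:
  assumes "monoid G" "S \<subseteq> carrier G"
  shows "wf_digraph (cayley_digraph G S)"
  using assms by unfold_locales (auto simp: cayley_digraph_def intro!: monoid.m_closed)

lemma finite_snake_lengths: "finite {length c | c. snake n c}"
proof -
  let ?G = "sym_cayley n"
  have sub: "tau ` {2..n} \<subseteq> carrier (sym_group n)"
    by (auto intro: tau_in_sym_group)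
  interpret wf_digraph ?G
    unfolding sym_cayley_def
    using sym_group_is_group group.is_monoid sub by (intro wf_cayley_digraph) auto
  have fin: "finite (arcs ?G)"
  proof (rule finite_subset)
    show "arcs ?G \<subseteq> verts ?G \<times> verts ?G"
      using tail_in_verts head_in_verts by (fastforce simp: sym_cayley_def cayley_digraph_def)
    show "finite (verts ?G \<times> verts ?G)"
      by (simp add: sym_cayley_def cayley_digraph_def sym_group_def finite_permutations)
  qed
  have "length c \<le> card (arcs ?G)" if "snake n c" for c
  proof -
    have "distinct c" "set c \<subseteq> arcs ?G"
      using that by (auto simp: snake_def cycle_conv awalk_def)
    then show ?thesis using fin by (metis card_mono distinct_card)
  qed
  then show ?thesis by (auto intro!: finite_subset[of _ "{..card (arcs ?G)}"])
qed

end

theory Submission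
  imports Defs
begin

text \<open>
  Induction from \<open>m\<close> to \<open>m + 2\<close>, starting with an explicit Hamiltonian cycle for \<open>m = 7\<close>. Fixing the
  last two letters splits \<open>A\<close> on \<open>m + 2\<close> letters into cosets of \<open>A\<close> on \<open>m\<close> letters, each carrying a
  relabelled copy of the cycle for \<open>m\<close>. Replacing \<open>\<tau>\<close> of index \<open>m\<close> by \<open>\<tau>\<close> of index \<open>m + 2\<close> at three
  vertices that differ by a rotation of the last three letters merges three such cycles into one; two
  of them are fresh, hence can be relabelled to fit. These merges preserve the parity of the number of
  cycles, which is wrong at the beginning (Rankin), so the first merge is a different one: a relation of
  even length between the rotations of the last three and of the last five letters joins six cycles at
  once. For the maximal length, a cycle without two permutations at distance one contains at most one
  of \<open>x\<close> and \<open>x \<circ> (1 2)\<close>.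
\<close>

subsection \<open>Cycles as arc sets\<close>

definition path_arcs :: "'a list \<Rightarrow> ('a \<times> 'a) set" where
  "path_arcs p = set (zip p (tl p))"

text \<open>Vertices and arcs are kept as sets and the list is hidden, so that cutting a cycle
  removes one pair and splicing paths is a union.\<close>

definition path_on :: "'a set \<Rightarrow> ('a \<times> 'a) set \<Rightarrow> 'a \<Rightarrow> 'a \<Rightarrow> bool" where
  "path_on V R x y \<longleftrightarrow>
     (\<exists>p. p \<noteq> [] \<and> distinct p \<and> set p = V \<and> R = path_arcs p \<and> hd p = x \<and> last p = y)"

definition cycle_on :: "'a set \<Rightarrow> ('a \<times> 'a) set \<Rightarrow> bool" where
  "cycle_on V R \<longleftrightarrow> (\<exists>x y R'. path_on V R' x y \<and> R = insert (y, x) R')"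

lemma path_arcs_append:
  assumes "p \<noteq> []" "q \<noteq> []"
  shows "path_arcs (p @ q) = insert (last p, hd q) (path_arcs p \<union> path_arcs q)"
  using assms
proof (induction p rule: induct_list012)
  case (2 x)
  then show ?case by (cases q) (auto simp: path_arcs_def)
next
  case (3 x y zs)
  then show ?case by (auto simp: path_arcs_def)
qed simp

text \<open>The sharper bound \<open>butlast\<close> shows that the last vertex of a distinct list
  emits no arc, which \<open>cycle_on_open\<close> needs.\<close>

lemma path_arcs_subset: "path_arcs p \<subseteq> set (butlast p) \<times> set p"
proof (induction p rule: induct_list012)
  case (3 x y zs)
  then show ?case by (auto simp: path_arcs_def)
qed (auto simp: path_arcs_def)

lemma path_arcsE:
  assumes "(x, y) \<in> path_arcs p"
  obtains p1 p2 where "p = (p1 @ [x]) @ y # p2"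
  using assms
proof (induction p arbitrary: thesis rule: induct_list012)
  case (3 a b zs)
  show ?case
  proof (cases "(x, y) = (a, b)")
    case True
    then show ?thesis using "3.prems"(1)[of "[]" zs] by simp
  next
    case False
    then have "(x, y) \<in> path_arcs (b # zs)"
      using "3.prems"(2) by (auto simp: path_arcs_def)
    then obtain p1 p2 where "b # zs = (p1 @ [x]) @ y # p2"
      using "3.IH"(2) by blast
    then show ?thesis using "3.prems"(1)[of "a # p1" p2] by simp
  qed
qed (auto simp: path_arcs_def)

lemma path_on_subset: "path_on V R x y \<Longrightarrow> R \<subseteq> V \<times> V"
  using path_arcs_subset unfolding path_on_def by (fastforce dest: in_set_butlastD)

lemma path_on_end: "path_on V R x y \<Longrightarrow> y \<in> V" "path_on V R x y \<Longrightarrow> x \<in> V"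
  unfolding path_on_def by auto

lemma path_on_append:
  assumes "path_on V R x y" "path_on W S u v" "V \<inter> W = {}"
  shows "path_on (V \<union> W) (insert (y, u) (R \<union> S)) x v"
proof -
  obtain p q where "p \<noteq> []" "distinct p" "set p = V" "R = path_arcs p" "hd p = x" "last p = y"
    "q \<noteq> []" "distinct q" "set q = W" "S = path_arcs q" "hd q = u" "last q = v"
    using assms(1,2) unfolding path_on_def by metis
  then show ?thesis
    using assms(3) unfolding path_on_def
    by (intro exI[of _ "p @ q"]) (auto simp: path_arcs_append)
qed

text \<open>Cutting at an arbitrary arc amounts to rotating the vertex list until that arc is the
  closing one.\<close>

lemma cycle_on_open:
  assumes "cycle_on V R" "(x, y) \<in> R"
  shows "path_on V (R - {(x, y)}) y x"
proof -
  obtain p where p: "p \<noteq> []" "distinct p" "set p = V"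
    and R: "R = insert (last p, hd p) (path_arcs p)"
    using assms(1) unfolding cycle_on_def path_on_def by metis
  show ?thesis
  proof (cases "(x, y) = (last p, hd p)")
    case True
    have "last p \<notin> set (butlast p)"
      using p by (metis append_butlast_last_id distinct_append disjoint_iff list.set_intros(1))
    then have "(x, y) \<notin> path_arcs p"
      using path_arcs_subset[of p] True by auto
    then have "R - {(x, y)} = path_arcs p" using R True by auto
    then show ?thesis using p True unfolding path_on_def by auto
  next
    case False
    then have "(x, y) \<in> path_arcs p" using assms(2) R by auto
    then obtain p1 p2 where eq: "p = (p1 @ [x]) @ y # p2" by (rule path_arcsE)
    \<comment> \<open>The two halves swapped: the old closing arc now joins them, and
      \<open>(x, y)\<close> becomes the closing pair.\<close>
    let ?q = "(y # p2) @ (p1 @ [x])"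
    have "(x, y) \<notin> path_arcs (y # p2)" "(x, y) \<notin> path_arcs (p1 @ [x])"
      using p(2) path_arcs_subset[of "y # p2"] path_arcs_subset[of "p1 @ [x]"]
        in_set_butlastD[of x "y # p2"] unfolding eq by auto
    moreover have ends: "hd p = hd (p1 @ [x])" "last p = last (y # p2)"
      unfolding eq by (cases p1) auto
    moreover have "path_arcs p = insert (x, y) (path_arcs (p1 @ [x]) \<union> path_arcs (y # p2))"
      unfolding eq by (subst path_arcs_append) auto
    moreover have "path_arcs ?q =
        insert (last p, hd p) (path_arcs (p1 @ [x]) \<union> path_arcs (y # p2))"
      unfolding ends by (subst path_arcs_append) auto
    ultimately have "R - {(x, y)} = path_arcs ?q"
      using False unfolding R by auto
    moreover have "distinct ?q" "set ?q = V" using p unfolding eq by auto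
    ultimately show ?thesis unfolding path_on_def by (intro exI[of _ ?q]) auto
  qed
qed

lemma cycle_on_image:
  assumes "cycle_on V R" "inj_on g V"
  shows "cycle_on (g ` V) (map_prod g g ` R)"
proof -
  obtain p where p: "p \<noteq> []" "distinct p" "set p = V"
    and R: "R = insert (last p, hd p) (path_arcs p)"
    using assms(1) unfolding cycle_on_def path_on_def by metis
  have "path_arcs (map g p) = map_prod g g ` path_arcs p"
    by (simp add: path_arcs_def zip_map_map map_prod_def flip: set_map map_tl)
  then show ?thesis
    using p assms(2) unfolding cycle_on_def path_on_def R
    by (intro exI[of _ "hd (map g p)"] exI[of _ "last (map g p)"] exI[of _ "path_arcs (map g p)"]
      conjI exI[of _ "map g p"])
      (auto simp: distinct_map hd_map last_map)
qed

lemma cycle_onE_list: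
  assumes "cycle_on V R"
  obtains p where "p \<noteq> []" "distinct p" "set p = V" "R = set (zip p (tl p @ [hd p]))"
proof -
  obtain p where p: "p \<noteq> []" "distinct p" "set p = V"
    and R: "R = insert (last p, hd p) (path_arcs p)"
    using assms(1) unfolding cycle_on_def path_on_def by metis
  have "set (zip p (tl p @ [a])) = insert (last p, a) (path_arcs p)" for a
    using p(1)
  proof (induction p rule: induct_list012)
    case (3 x y zs)
    then show ?case by (auto simp: path_arcs_def)
  qed (auto simp: path_arcs_def)
  with p R that show ?thesis by blast
qed

section \<open>Translation into the cycles of the graph library\<close>

lemma cas_zip:
  assumes "tail G = fst" "head G = snd" "p \<noteq> []"
  shows "pre_digraph.cas G (hd p) (zip p (tl p @ [v])) v"
  using assms(3)
proof (induction p rule: induct_list012)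
  case (2 x)
  then show ?case by (simp add: pre_digraph.cas.simps assms)
next
  case (3 x y zs)
  then show ?case by (simp add: pre_digraph.cas.simps assms)
qed simp

lemma cycle_on_imp_cycle:
  assumes "cycle_on V R" "V \<subseteq> verts G" "R \<subseteq> arcs G" "tail G = fst" "head G = snd"
  shows "\<exists>c. pre_digraph.cycle G c \<and> cycle_verts G c = V \<and> length c = card V"
proof -
  obtain p where p: "p \<noteq> []" "distinct p" "set p = V" and R: "R = set (zip p (tl p @ [hd p]))"
    using assms(1) by (rule cycle_onE_list)
  let ?c = "zip p (tl p @ [hd p])"
  have len: "length (tl p @ [hd p]) = length p" using p(1) by simp
  have cas: "pre_digraph.cas G (hd p) ?c (hd p)"
    using cas_zip[OF assms(4,5) p(1)] .
  have ne: "?c \<noteq> []" using p(1) by (cases p) auto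
  have "pre_digraph.awalk_verts G (hd p) ?c = tail G (hd ?c) # map (head G) ?c"
    using pre_digraph.awalk_verts_conv'[OF cas] ne by simp
  moreover have "map (head G) ?c = tl p @ [hd p]"
    using len assms(5) by (simp add: map_snd_zip_take)
  moreover have "distinct (tl p @ [hd p])"
    using p(1,2) by (cases p) auto
  moreover have "pre_digraph.awalk G (hd p) ?c (hd p)"
    unfolding pre_digraph.awalk_def using cas p assms(2,3) R by auto
  ultimately have "pre_digraph.cycle G ?c"
    unfolding pre_digraph.cycle_def using ne by (metis list.sel(3))
  moreover have "cycle_verts G ?c = V"
    unfolding cycle_verts_def using len assms(4) p(3) by (simp add: map_fst_zip_take flip: set_map)
  moreover have "length ?c = card V" using p distinct_card[of p] len by simp
  ultimately show ?thesis by blast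
qed

subsection \<open>Blocks\<close>

abbreviation alt :: "nat \<Rightarrow> (nat \<Rightarrow> nat) set" where
  "alt n \<equiv> carrier (alt_group n)"

lemma alt_comp: "x \<in> alt n \<Longrightarrow> y \<in> alt n \<Longrightarrow> x \<circ> y \<in> alt n"
  using alt_group_is_group[of n] by (metis alt_group_mult group.is_monoid monoid.m_closed)

lemma alt_add2: "x \<in> alt m \<Longrightarrow> x \<in> alt (m + 2)"
  by (auto simp: alt_group_carrier intro: permutes_subset)

lemma alt_inj: "x \<in> alt n \<Longrightarrow> inj x"
  by (auto simp: alt_group_carrier permutes_inj)

lemma alt_inv_comp:
  assumes "x \<in> alt n"
  shows "inv' x \<circ> x = id" "x \<circ> inv' x = id"
  using assms permutes_inv_o unfolding alt_group_carrier by blast+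

text \<open>Position 1 of \<open>x \<circ> tau k\<close> carries the letter \<open>x k\<close>, so
  an arc determines its index.\<close>

lemma alt_comp_tau_inject:
  assumes "x \<in> alt n" "x \<circ> tau k = x \<circ> tau l"
  shows "k = l"
proof -
  have "x (tau k 1) = x (tau l 1)" using assms(2) by (metis comp_apply)
  then show ?thesis using alt_inj[OF assms(1)] by (simp add: tau_def inj_eq)
qed

definition jumps :: "nat \<Rightarrow> ((nat \<Rightarrow> nat) \<times> (nat \<Rightarrow> nat)) set" where
  "jumps n = {(x, x \<circ> tau k) | x k. 3 \<le> k \<and> k \<le> n \<and> odd k}"

lemma jumps_mono: "m \<le> n \<Longrightarrow> jumps m \<subseteq> jumps n"
  unfolding jumps_def by fastforce

text \<open>The elements of \<open>alt (m + 2)\<close> with prescribed last two letters form a left coset of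
  \<open>alt m\<close>. Left multiplication commutes with jumping, so a cycle on \<open>alt m\<close> can be transported to
  each of these cosets, and any one vertex can be moved to any chosen place.\<close>

definition block :: "nat \<Rightarrow> nat \<times> nat \<Rightarrow> (nat \<Rightarrow> nat) set" where
  "block m c = {x \<in> alt (m + 2). (x (m + 1), x (m + 2)) = c}"

lemma block_translate:
  assumes "g \<in> block m c"
  shows "(\<circ>) g ` alt m = block m c"
proof
  have fix2: "h (m + 1) = m + 1" "h (m + 2) = m + 2" if "h \<in> alt m" for h
    using that by (auto simp: alt_group_carrier permutes_def)
  show "(\<circ>) g ` alt m \<subseteq> block m c"
  proof (rule image_subsetI)
    fix h assume h: "h \<in> alt m"
    have "g \<circ> h \<in> alt (m + 2)"
      using assms alt_add2[OF h] by (intro alt_comp) (auto simp: block_def)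
    then show "g \<circ> h \<in> block m c"
      using assms fix2[OF h] unfolding block_def by (simp only: mem_Collect_eq comp_apply)
  qed
  show "block m c \<subseteq> (\<circ>) g ` alt m"
  proof
    fix y assume y: "y \<in> block m c"
    have g: "g \<in> alt (m + 2)" and y': "y \<in> alt (m + 2)" using assms y by (auto simp: block_def)
    define h where "h = inv' g \<circ> y"
    have h: "h \<in> alt (m + 2)"
      unfolding h_def using g y' by (intro alt_comp alt_group_inv_closed)
    \<comment> \<open>\<open>g\<close> and \<open>y\<close> agree at the last two positions, so
      \<open>inv' g\<close> undoes \<open>y\<close> there.\<close>
    have fix_h: "h (m + 1) = m + 1" "h (m + 2) = m + 2"
      using assms y alt_inj[OF g] by (auto simp: block_def h_def inv_f_eq)
    have "h permutes {1..m}"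
    proof (rule permutes_superset)
      show "h permutes {1..m + 2}" using h by (simp add: alt_group_carrier)
      show "h i = i" if "i \<in> {1..m + 2} - {1..m}" for i
      proof -
        have "i = m + 1 \<or> i = m + 2" using that by auto
        then show ?thesis using fix_h by auto
      qed
    qed
    then have "h \<in> alt m" using h by (simp add: alt_group_carrier)
    moreover have "g \<circ> h = y"
      using g by (simp add: h_def comp_assoc[symmetric] alt_inv_comp)
    ultimately show "y \<in> (\<circ>) g ` alt m" by blast
  qed
qed

text \<open>Jumps to the front from the last position are needed after every last letter so that a block
  can be attached to any of its neighbours; the last condition feeds the six-block gadget.\<close>

definition good :: "nat \<Rightarrow> ((nat \<Rightarrow> nat) \<times> (nat \<Rightarrow> nat)) set \<Rightarrow> bool" where
  "good m R \<longleftrightarrow> cycle_on (alt m) R \<and> R \<subseteq> jumps m \<and>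
     (\<forall>r\<in>{1..m}. \<exists>x. x m = r \<and> (x, x \<circ> tau m) \<in> R) \<and> (\<exists>x. (x, x \<circ> tau (m - 2)) \<in> R)"

lemma cycle_on_subset: "cycle_on V R \<Longrightarrow> R \<subseteq> V \<times> V"
  unfolding cycle_on_def using path_on_subset path_on_end by fastforce

text \<open>Left multiplication by \<open>g = z \<circ> inv' h\<close>, where \<open>h\<close> emits
  an arc of index \<open>s\<close> in \<open>R\<close>, carries \<open>h\<close> to
  \<open>z\<close>. The letter \<open>r\<close> is the image under \<open>g\<close> of some letter
  in \<open>{1..m}\<close>, because \<open>g\<close> sends \<open>m + 1\<close> and
  \<open>m + 2\<close> to the two letters in \<open>c\<close>.\<close>

lemma good_copy:
  assumes "good m R" "s = m \<or> s = m - 2" "1 \<le> m" "z \<in> block m c"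
  obtains R' where "cycle_on (block m c) R'" "R' \<subseteq> jumps m" "(z, z \<circ> tau s) \<in> R'"
    "\<And>r. r \<in> {1..m + 2} - {fst c, snd c} \<Longrightarrow> \<exists>x\<in>block m c. x m = r \<and> (x, x \<circ> tau m) \<in> R'"
proof -
  have R: "cycle_on (alt m) R" "R \<subseteq> jumps m"
    and letters: "\<And>r. r \<in> {1..m} \<Longrightarrow> \<exists>x. x m = r \<and> (x, x \<circ> tau m) \<in> R"
    using assms(1) by (auto simp: good_def)
  obtain h where hR: "(h, h \<circ> tau s) \<in> R"
    using assms(1-3) letters[of 1] by (auto simp: good_def)
  then have h: "h \<in> alt m" using cycle_on_subset[OF R(1)] by auto
  have h': "inv' h \<in> alt m" using h by (rule alt_group_inv_closed)
  define g where "g = z \<circ> inv' h"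
  have g: "g \<in> block m c"
    using block_translate[OF assms(4)] h' unfolding g_def by blast
  have gh: "g \<circ> h = z"
    using h by (simp add: g_def comp_assoc alt_inv_comp)
  let ?R = "map_prod ((\<circ>) g) ((\<circ>) g) ` R"
  have inj_g: "inj g" using g by (auto simp: block_def alt_inj)
  have "inj_on ((\<circ>) g) (alt m)"
    by (intro inj_onI) (metis inj_g fun.inj_map injD)
  from cycle_on_image[OF R(1) this] have cyc: "cycle_on (block m c) ?R"
    unfolding block_translate[OF g] .
  show ?thesis
  proof (rule that)
    show "cycle_on (block m c) ?R" by (fact cyc)
    show "?R \<subseteq> jumps m"
    proof (rule image_subsetI)
      fix a assume "a \<in> R"
      then obtain x k where "a = (x, x \<circ> tau k)" "3 \<le> k" "k \<le> m" "odd k"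
        using R(2) unfolding jumps_def by blast
      then show "map_prod ((\<circ>) g) ((\<circ>) g) a \<in> jumps m"
        unfolding jumps_def by (auto simp: comp_assoc)
    qed
    show "(z, z \<circ> tau s) \<in> ?R"
      using imageI[OF hR, of "map_prod ((\<circ>) g) ((\<circ>) g)"] gh
      by (simp add: comp_assoc[symmetric])
    fix r assume r: "r \<in> {1..m + 2} - {fst c, snd c}"
    have "g permutes {1..m + 2}" 
      using g unfolding block_def alt_group_carrier by blast
    from permutes_image[OF this] have "r \<in> g ` {1..m + 2}" using r by (metis DiffD1)
    then obtain r' where r': "r' \<in> {1..m + 2}" "g r' = r" by auto
    have "r' \<noteq> m + 1" "r' \<noteq> m + 2" using r r' g by (auto simp: block_def)
    then have "r' \<in> {1..m}" using r' by auto
    then obtain x where x: "x m = r'" "(x, x \<circ> tau m) \<in> R" using letters by blast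
    then have "(g \<circ> x, (g \<circ> x) \<circ> tau m) \<in> ?R"
      using imageI[OF x(2), of "map_prod ((\<circ>) g) ((\<circ>) g)"] by (simp add: comp_assoc)
    moreover then have "g \<circ> x \<in> block m c" 
      using cycle_on_subset[OF cyc] by (meson SigmaD1 subsetD)
    ultimately show "\<exists>x\<in>block m c. x m = r \<and> (x, x \<circ> tau m) \<in> ?R"
      using x(1) r'(2) by (metis comp_apply)
  qed
qed

text \<open>Cutting the copy after \<open>z\<close> can cost an arc of index \<open>m\<close> only
  if \<open>s = m\<close>, and then only the one for the letter \<open>z m\<close>. The surviving
  arc of index \<open>m\<close> eventually serves the last clause of
  \<open>good (m + 2)\<close>.\<close>

lemma good_copy_path:
  assumes "good m R" "s = m \<or> s = m - 2" "3 \<le> m" "z \<in> block m (c, d)"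
  obtains R' where "path_on (block m (c, d)) R' (z \<circ> tau s) z" "R' \<subseteq> jumps (m + 2)"
    "\<And>r. r \<in> {1..m + 2} - {c, d} \<Longrightarrow> s \<noteq> m \<or> r \<noteq> z m \<Longrightarrow>
        \<exists>x\<in>block m (c, d). x m = r \<and> (x, x \<circ> tau m) \<in> R'"
    "\<exists>u. (u, u \<circ> tau m) \<in> R'"
proof -
  have "1 \<le> m" using assms(3) by simp
  obtain R1 where R1: "cycle_on (block m (c, d)) R1" "R1 \<subseteq> jumps m" "(z, z \<circ> tau s) \<in> R1"
    and letters: "\<And>r. r \<in> {1..m + 2} - {c, d} \<Longrightarrow>
          \<exists>x\<in>block m (c, d). x m = r \<and> (x, x \<circ> tau m) \<in> R1"
    using good_copy[OF assms(1,2) \<open>1 \<le> m\<close> assms(4)] by auto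
  let ?R = "R1 - {(z, z \<circ> tau s)}"
  have "?R \<subseteq> jumps (m + 2)" using R1(2) jumps_mono[of m "m + 2"] by auto
  moreover have let': "\<exists>x\<in>block m (c, d). x m = r \<and> (x, x \<circ> tau m) \<in> ?R"
    if r: "r \<in> {1..m + 2} - {c, d}" "s \<noteq> m \<or> r \<noteq> z m" for r
  proof -
    obtain x where x: "x \<in> block m (c, d)" "x m = r" "(x, x \<circ> tau m) \<in> R1"
      using letters r(1) by blast
    have "(x, x \<circ> tau m) \<noteq> (z, z \<circ> tau s)"
      using r(2) x alt_comp_tau_inject[of x "m + 2" m s] by (auto simp: block_def)
    then show ?thesis using x by blast
  qed
  moreover have "\<exists>u. (u, u \<circ> tau m) \<in> ?R"
  proof -
    \<comment> \<open>At least five letters are present and at most three are excluded.\<close>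
    have "card {c, d, z m} \<le> 3"
      using card_length[of "[c, d, z m]"] by simp
    then have "\<not> {1..m + 2} \<subseteq> {c, d, z m}"
      using card_mono[of "{c, d, z m}" "{1..m + 2}"] assms(3) by auto
    then obtain r where "r \<in> {1..m + 2} - {c, d, z m}" by blast
    then show ?thesis using let'[of r] by blast
  qed
  ultimately show ?thesis using that cycle_on_open[OF R1(1,3)] by blast
qed

subsection \<open>Joining blocks\<close>

text \<open>\<open>S\<close> is the set of blocks joined so far and \<open>T\<close> the set that will be joined once the path is
  closed up: a triangle \<open>p, q, r\<close> of blocks with a side in \<open>S\<close> can still be glued in unless another
  side of it belongs to \<open>T\<close>.\<close>

definition avail ::
  "nat \<Rightarrow> (nat \<times> nat) set \<Rightarrow> (nat \<times> nat) set \<Rightarrow> ((nat \<Rightarrow> nat) \<times> (nat \<Rightarrow> nat)) set \<Rightarrow> bool" where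
  "avail m S T R \<longleftrightarrow>
     (\<forall>p q r. (p, q) \<in> S \<longrightarrow> r \<in> {1..m + 2} - {p, q} \<longrightarrow> (q, r) \<notin> T \<longrightarrow> (r, p) \<notin> T \<longrightarrow>
        (\<exists>x\<in>block m (p, q). x m = r \<and> (x, x \<circ> tau m) \<in> R))"

text \<open>The path is meant to leave its end \<open>z\<close> by the jump of index
  \<open>m + 2\<close>. That arc is still missing, hence the exemption for the block of
  \<open>z\<close> in the last clause.\<close>

definition chain ::
  "nat \<Rightarrow> (nat \<times> nat) set \<Rightarrow> (nat \<times> nat) set \<Rightarrow> ((nat \<Rightarrow> nat) \<times> (nat \<Rightarrow> nat)) set
     \<Rightarrow> (nat \<Rightarrow> nat) \<Rightarrow> (nat \<Rightarrow> nat) \<Rightarrow> bool" where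
  "chain m S T R w z \<longleftrightarrow> path_on (\<Union> (block m ` S)) R w z \<and> R \<subseteq> jumps (m + 2) \<and>
     avail m S T R \<and>
     (\<forall>c\<in>S. z \<notin> block m c \<longrightarrow> (\<exists>x\<in>block m c. (x, x \<circ> tau (m + 2)) \<in> R))"

text \<open>The clauses on the indices \<open>m\<close> and \<open>m + 2\<close> turn into the last
  two clauses of \<open>good (m + 2)\<close> once \<open>S\<close> contains every block.\<close>

definition grown :: "nat \<Rightarrow> (nat \<times> nat) set \<Rightarrow> ((nat \<Rightarrow> nat) \<times> (nat \<Rightarrow> nat)) set \<Rightarrow> bool" where
  "grown m S R \<longleftrightarrow> cycle_on (\<Union> (block m ` S)) R \<and> R \<subseteq> jumps (m + 2) \<and>
     (\<exists>u. (u, u \<circ> tau m) \<in> R) \<and> avail m S S R \<and>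
     (\<forall>c\<in>S. \<exists>x\<in>block m c. (x, x \<circ> tau (m + 2)) \<in> R)"

text \<open>The first cut removes an arc of index \<open>m - 2\<close>, so the arcs of index
  \<open>m\<close> survive and \<open>T\<close> may be arbitrary.\<close>

lemma chain_start:
  assumes "good m R" "3 \<le> m" "z \<in> block m c"
  shows "\<exists>R'. chain m {c} T R' (z \<circ> tau (m - 2)) z"
proof -
  obtain p q where c: "c = (p, q)" by fastforce
  have s: "m - 2 \<noteq> m" using assms(2) by simp
  obtain R' where R': "path_on (block m (p, q)) R' (z \<circ> tau (m - 2)) z" "R' \<subseteq> jumps (m + 2)"
    "\<And>r. r \<in> {1..m + 2} - {p, q} \<Longrightarrow> \<exists>x\<in>block m (p, q). x m = r \<and> (x, x \<circ> tau m) \<in> R'"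
    "\<exists>u. (u, u \<circ> tau m) \<in> R'"
    using good_copy_path[OF assms(1) _ assms(2), of "m - 2" z p q] assms(3) s unfolding c by metis
  then have "avail m {c} T R'" unfolding avail_def c by auto
  with R' assms(3) show ?thesis unfolding chain_def c by auto
qed

text \<open>The jump of index \<open>m + 2\<close> from \<open>z\<close> lands on
  \<open>z \<circ> \<theta> \<circ> tau s\<close>. A copy of the cycle in the new block is cut just
  before this vertex, so the path runs through the whole block and ends at
  \<open>z \<circ> \<theta>\<close>. If \<open>s = m\<close>, the cut loses the letter
  \<open>(z \<circ> \<theta>) m\<close>, and the last assumption lets \<open>T\<close> excuse
  it.\<close>

lemma chain_extend:
  assumes "good m R0" "odd m" "3 \<le> m" "chain m S T R w z"
    and "\<theta> \<circ> tau s = tau (m + 2)" "s = m \<or> s = m - 2"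
    and "z \<circ> \<theta> \<in> block m (c, d)" "(c, d) \<notin> S"
    and "s = m \<Longrightarrow> (d, (z \<circ> \<theta>) m) \<in> T \<or> ((z \<circ> \<theta>) m, c) \<in> T"
  shows "\<exists>R'. chain m (insert (c, d) S) T R' w (z \<circ> \<theta>) \<and> (\<exists>u. (u, u \<circ> tau m) \<in> R')"
proof -
  let ?y = "z \<circ> \<theta>"
  have ch: "path_on (\<Union> (block m ` S)) R w z" "R \<subseteq> jumps (m + 2)" "avail m S T R"
    "\<And>c. c \<in> S \<Longrightarrow> z \<notin> block m c \<Longrightarrow> \<exists>x\<in>block m c. (x, x \<circ> tau (m + 2)) \<in> R"
    using assms(4) unfolding chain_def by auto
  obtain R1 where R1: "path_on (block m (c, d)) R1 (?y \<circ> tau s) ?y" "R1 \<subseteq> jumps (m + 2)"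
    and u: "\<exists>u. (u, u \<circ> tau m) \<in> R1"
    and let1: "\<And>r. r \<in> {1..m + 2} - {c, d} \<Longrightarrow> s \<noteq> m \<or> r \<noteq> ?y m \<Longrightarrow>
        \<exists>x\<in>block m (c, d). x m = r \<and> (x, x \<circ> tau m) \<in> R1"
    using good_copy_path[OF assms(1,6,3,7)] by metis
  have ys: "?y \<circ> tau s = z \<circ> tau (m + 2)" using assms(5) by (simp add: comp_assoc)
  let ?R = "insert (z, z \<circ> tau (m + 2)) (R \<union> R1)"
  have "\<Union> (block m ` S) \<inter> block m (c, d) = {}"
    using assms(8) by (auto simp: block_def)
  from path_on_append[OF ch(1) R1(1) this]
  have "path_on (\<Union> (block m ` insert (c, d) S)) ?R w ?y"
    unfolding ys image_insert Union_insert Un_commute[of "block m (c, d)"] .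
  moreover have "?R \<subseteq> jumps (m + 2)"
  proof -
    have "(z, z \<circ> tau (m + 2)) \<in> jumps (m + 2)"
      unfolding jumps_def using assms(2,3) by auto
    then show ?thesis using ch(2) R1(2) by blast
  qed
  moreover have "\<exists>u. (u, u \<circ> tau m) \<in> ?R" using u by blast
  moreover have "avail m (insert (c, d) S) T ?R"
    unfolding avail_def
  proof (intro allI impI)
    fix p q r
    assume pq: "(p, q) \<in> insert (c, d) S" "r \<in> {1..m + 2} - {p, q}" "(q, r) \<notin> T" "(r, p) \<notin> T"
    show "\<exists>x\<in>block m (p, q). x m = r \<and> (x, x \<circ> tau m) \<in> ?R"
    proof (cases "(p, q) \<in> S")
      case True
      then show ?thesis using ch(3) pq unfolding avail_def by blast
    next
      case False
      then have "p = c" "q = d" using pq by auto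
      moreover have "s \<noteq> m \<or> r \<noteq> ?y m" using assms(9) pq calculation by blast
      ultimately obtain x where "x \<in> block m (c, d)" "x m = r" "(x, x \<circ> tau m) \<in> R1"
        using let1 pq(2) by metis
      then show ?thesis using \<open>p = c\<close> \<open>q = d\<close> by auto
    qed
  qed
  moreover have "\<exists>x\<in>block m c'. (x, x \<circ> tau (m + 2)) \<in> ?R"
    if c': "c' \<in> insert (c, d) S" "?y \<notin> block m c'" for c'
  proof (cases "z \<in> block m c'")
    case False
    have "c' \<in> S" using c' assms(7) by auto
    then show ?thesis using ch(4) False by blast
  qed blast
  ultimately show ?thesis unfolding chain_def by blast
qed

lemma tau_in_jumps: "3 \<le> k \<Longrightarrow> k \<le> n \<Longrightarrow> odd k \<Longrightarrow> (x, x \<circ> tau k) \<in> jumps n"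
  unfolding jumps_def by blast

text \<open>The closing jump also supplies the arc of index \<open>m + 2\<close> for the block of
  \<open>z\<close>, the one exempted in \<open>chain\<close>.\<close>

lemma chain_close:
  assumes "chain m S S R (z \<circ> tau (m + 2)) z" "odd m" "\<exists>u. (u, u \<circ> tau m) \<in> R"
  shows "\<exists>R. grown m S R"
proof -
  let ?R = "insert (z, z \<circ> tau (m + 2)) R"
  have ch: "path_on (\<Union> (block m ` S)) R (z \<circ> tau (m + 2)) z" "R \<subseteq> jumps (m + 2)" "avail m S S R"
    "\<And>c. c \<in> S \<Longrightarrow> z \<notin> block m c \<Longrightarrow> \<exists>x\<in>block m c. (x, x \<circ> tau (m + 2)) \<in> R"
    using assms(1) unfolding chain_def by auto
  have "3 \<le> m + 2" using assms(2) by (cases m) auto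
  then have "?R \<subseteq> jumps (m + 2)" using ch(2) tau_in_jumps assms(2) by simp
  moreover have "cycle_on (\<Union> (block m ` S)) ?R" using ch(1) unfolding cycle_on_def by metis
  moreover have "avail m S S ?R"
    unfolding avail_def
  proof (intro allI impI)
    fix p q r assume "(p, q) \<in> S" "r \<in> {1..m + 2} - {p, q}" "(q, r) \<notin> S" "(r, p) \<notin> S"
    then obtain x where "x \<in> block m (p, q)" "x m = r" "(x, x \<circ> tau m) \<in> R"
      using ch(3) unfolding avail_def by metis
    then show "\<exists>x\<in>block m (p, q). x m = r \<and> (x, x \<circ> tau m) \<in> ?R" by auto
  qed
  moreover have "\<exists>x\<in>block m c. (x, x \<circ> tau (m + 2)) \<in> ?R" if "c \<in> S" for c
    using ch(4)[OF that] by blast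
  moreover have "\<exists>u. (u, u \<circ> tau m) \<in> ?R" using assms(3) by auto
  ultimately show ?thesis unfolding grown_def by metis
qed

text \<open>The cut spends the arc belonging to the triangle \<open>p, q, x m\<close>; having
  \<open>(q, x m)\<close> in \<open>T\<close> exempts that triangle.\<close>

lemma chain_open:
  assumes "grown m S R" "(x, x \<circ> tau m) \<in> R" "x \<in> block m (p, q)"
    "insert (q, x m) S \<subseteq> T"
  shows "\<exists>R'. chain m S T R' (x \<circ> tau m) x"
proof -
  let ?R = "R - {(x, x \<circ> tau m)}"
  have gr: "cycle_on (\<Union> (block m ` S)) R" "R \<subseteq> jumps (m + 2)" "avail m S S R"
    "\<And>c. c \<in> S \<Longrightarrow> \<exists>x\<in>block m c. (x, x \<circ> tau (m + 2)) \<in> R"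
    using assms(1) unfolding grown_def by auto
  have "path_on (\<Union> (block m ` S)) ?R (x \<circ> tau m) x"
    by (rule cycle_on_open[OF gr(1) assms(2)])
  moreover have "?R \<subseteq> jumps (m + 2)" using gr(2) by auto
  moreover have "avail m S T ?R"
    unfolding avail_def
  proof (intro allI impI)
    fix p' q' r
    assume pq: "(p', q') \<in> S" "r \<in> {1..m + 2} - {p', q'}" "(q', r) \<notin> T" "(r, p') \<notin> T"
    then obtain y where y: "y \<in> block m (p', q')" "y m = r" "(y, y \<circ> tau m) \<in> R"
      using gr(3) assms(4) unfolding avail_def by blast
    have "y \<noteq> x" using y assms(3,4) pq by (auto simp: block_def)
    with y show "\<exists>x\<in>block m (p', q'). x m = r \<and> (x, x \<circ> tau m) \<in> ?R" by blast
  qed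
  moreover have "\<exists>y\<in>block m c. (y, y \<circ> tau (m + 2)) \<in> ?R" if "c \<in> S" "x \<notin> block m c" for c
    using gr(4)[OF that(1)] that(2) by blast
  ultimately show ?thesis unfolding chain_def by blast
qed

section \<open>Rotations of the last three and the last five letters\<close>

definition rot3 :: "nat \<Rightarrow> nat \<Rightarrow> nat" where
  "rot3 m i = (if i = m then m + 2 else if m < i \<and> i \<le> m + 2 then i - 1 else i)"

definition rot5 :: "nat \<Rightarrow> nat \<Rightarrow> nat" where
  "rot5 m i = (if i = m - 2 then m + 2 else if m - 2 < i \<and> i \<le> m + 2 then i - 1 else i)"

text \<open>Hence \<open>x\<close> under index \<open>m + 2\<close> and
  \<open>x \<circ> rot3 m\<close> under index \<open>m\<close> have the same successor; this allows
  arcs to be exchanged.\<close>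

lemma rot3_tau: "3 \<le> m \<Longrightarrow> rot3 m \<circ> tau m = tau (m + 2)"
  by (rule ext) (simp add: rot3_def tau_def, linarith)

lemma rot5_tau: "5 \<le> m \<Longrightarrow> rot5 m \<circ> tau (m - 2) = tau (m + 2)"
  by (rule ext) (simp add: rot5_def tau_def, linarith)

text \<open>Evenness needs no separate parity count: \<open>\<theta>\<close> is the quotient
  \<open>tau n \<circ> inv' (tau s)\<close> of two even permutations.\<close>

lemma comp_tau_in_altD:
  assumes "\<theta> \<circ> tau s = tau n" "3 \<le> s" "s \<le> n" "odd s" "odd n"
  shows "\<theta> \<in> alt n"
proof -
  have s: "tau s \<in> alt n" and n: "tau n \<in> alt n" using assms tau_in_alt_group by auto
  have "\<theta> = tau n \<circ> inv' (tau s)"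
    using alt_inv_comp(2)[OF s] by (simp add: assms(1)[symmetric] comp_assoc)
  then show ?thesis using alt_comp[OF n alt_group_inv_closed[OF s]] by simp
qed

lemma rot3_in_alt: "3 \<le> m \<Longrightarrow> odd m \<Longrightarrow> rot3 m \<in> alt (m + 2)"
  using comp_tau_in_altD[OF rot3_tau] by simp

lemma rot5_in_alt: "5 \<le> m \<Longrightarrow> odd m \<Longrightarrow> rot5 m \<in> alt (m + 2)"
  using comp_tau_in_altD[OF rot5_tau] by simp

text \<open>Blocks are arcs of the complete digraph on \<open>{1..m + 2}\<close>. The rotation \<open>rot3 m\<close> glues the three
  blocks of a cyclic triangle, so it adds two arcs at a time; since the number of arcs is even, this
  never exhausts them when started from one arc. The start is instead a bow-tie, two cyclic triangles
  with a common vertex, whose six blocks are glued by the relation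
  \<open>rot5 \<circ> rot3 \<circ> rot5 \<circ> rot5 \<circ> rot3 \<circ> rot5 = id\<close>.\<close>

inductive reach :: "nat \<Rightarrow> (nat \<times> nat) set \<Rightarrow> bool" for m where
  bowtie: "reach m {(m + 1, m + 2), (m, m + 1), (m - 1, m), (m + 1, m - 1), (m - 2, m + 1), (m + 2, m - 2)}"
| triangle: "\<lbrakk>reach m S; (p, q) \<in> S; r \<in> {1..m + 2} - {p, q}; (q, r) \<notin> S; (r, p) \<notin> S\<rbrakk>
    \<Longrightarrow> reach m (insert (q, r) (insert (r, p) S))"

text \<open>The path visits the partial products of the relation, one per block, starting from
  \<open>id\<close>. Factors \<open>rot5\<close> cut an arc of index \<open>m - 2\<close>, factors
  \<open>rot3\<close> one of index \<open>m\<close>; the letter lost by the latter completes a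
  triangle of the bow-tie, so \<open>?T\<close> excuses it.\<close>

lemma grown_bowtie:
  assumes "good m R" "odd m" "5 \<le> m"
  shows "\<exists>R. grown m {(m + 1, m + 2), (m, m + 1), (m - 1, m), (m + 1, m - 1),
    (m - 2, m + 1), (m + 2, m - 2)} R"
proof -
  have m3: "3 \<le> m" using assms(3) by simp
  define k where "k = m - 2"
  have k: "m = k + 2" using assms(3) by (simp add: k_def)
  let ?T = "{(k + 3, k + 4), (k + 2, k + 3), (k + 1, k + 2), (k + 3, k + 1), (k, k + 3), (k + 4, k)}"
  define \<theta> \<rho> where "\<theta> = rot5 m" and "\<rho> = rot3 m"
  have \<theta>: "\<theta> k = k + 4" "\<theta> (k + 1) = k" "\<theta> (k + 2) = k + 1" "\<theta> (k + 3) = k + 2" "\<theta> (k + 4) = k + 3"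
    "i < k \<or> k + 4 < i \<Longrightarrow> \<theta> i = i" for i
    unfolding \<theta>_def rot5_def k by auto
  have \<rho>: "\<rho> k = k" "\<rho> (k + 1) = k + 1" "\<rho> (k + 2) = k + 4" "\<rho> (k + 3) = k + 2" "\<rho> (k + 4) = k + 3"
    "i < k \<or> k + 4 < i \<Longrightarrow> \<rho> i = i" for i
    unfolding \<rho>_def rot3_def k by auto
  note vals = \<theta>[simplified] \<rho>[simplified]
  have alt: "\<theta> \<in> alt (k + 4)" "\<rho> \<in> alt (k + 4)"
    using rot5_in_alt[OF assms(3,2)] rot3_in_alt[OF m3 assms(2)] unfolding \<theta>_def \<rho>_def k
    by (simp_all add: numeral_eq_Suc)
  have id: "id \<in> alt (k + 4)" by (simp add: alt_group_carrier permutes_id evenperm_id)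
  have blk: "z \<in> block m c \<longleftrightarrow> z \<in> alt (k + 4) \<and> (z (k + 3), z (k + 4)) = c" for z c
    unfolding block_def k by (simp add: numeral_eq_Suc)
  note extend5 = chain_extend[OF assms(1,2) m3 _ rot5_tau[OF assms(3), folded \<theta>_def] disjI2[OF refl],
      unfolded blk]
  note extend3 = chain_extend[OF assms(1,2) m3 _ rot3_tau[OF m3, folded \<rho>_def] disjI1[OF refl],
      unfolded blk]
  have ne: "m - 2 \<noteq> m" using m3 by simp
  \<comment> \<open>The successor of \<open>id\<close> in the first copy: the path starts here, and
    the last jump has to return here.\<close>
  define w where "w = id \<circ> tau (m - 2)"
  have "\<exists>R. chain m {(k + 3, k + 4)} ?T R w id"
    unfolding w_def using id by (intro chain_start[OF assms(1) m3]) (simp add: blk)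
  then obtain R1 where R1: "chain m {(k + 3, k + 4)} ?T R1 w id" ..
  have z2: "\<theta> \<in> alt (k + 4)" using alt by simp
  obtain R2 where R2: "chain m {(k + 2, k + 3), (k + 3, k + 4)} ?T R2 w \<theta>"
    using extend5[OF R1, of "k + 2" "k + 3"] z2 ne by (auto simp: vals)
  have z3: "\<theta> \<circ> \<rho> \<in> alt (k + 4)" using alt_comp[OF z2] alt by simp
  obtain R3 where R3: "chain m {(k + 1, k + 2), (k + 2, k + 3), (k + 3, k + 4)} ?T R3 w (\<theta> \<circ> \<rho>)"
    using extend3[OF R2, of "k + 1" "k + 2"] z3 by (auto simp: vals k)
  have z4: "\<theta> \<circ> \<rho> \<circ> \<theta> \<in> alt (k + 4)" using alt_comp[OF z3] alt by simp
  obtain R4 where R4: "chain m {(k + 3, k + 1), (k + 1, k + 2), (k + 2, k + 3), (k + 3, k + 4)} ?T R4 w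
      (\<theta> \<circ> \<rho> \<circ> \<theta>)"
    using extend5[OF R3, of "k + 3" "k + 1"] z4 ne by (auto simp: vals)
  have z5: "\<theta> \<circ> \<rho> \<circ> \<theta> \<circ> \<theta> \<in> alt (k + 4)" using alt_comp[OF z4] alt by simp
  obtain R5 where R5: "chain m {(k, k + 3), (k + 3, k + 1), (k + 1, k + 2), (k + 2, k + 3),
      (k + 3, k + 4)} ?T R5 w (\<theta> \<circ> \<rho> \<circ> \<theta> \<circ> \<theta>)"
    using extend5[OF R4, of k "k + 3"] z5 ne by (auto simp: vals)
  have z6: "\<theta> \<circ> \<rho> \<circ> \<theta> \<circ> \<theta> \<circ> \<rho> \<in> alt (k + 4)" using alt_comp[OF z5] alt by simp
  obtain R6 where R6: "chain m {(k + 4, k), (k, k + 3), (k + 3, k + 1), (k + 1, k + 2), (k + 2, k + 3),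
      (k + 3, k + 4)} ?T R6 w (\<theta> \<circ> \<rho> \<circ> \<theta> \<circ> \<theta> \<circ> \<rho>)" "\<exists>u. (u, u \<circ> tau m) \<in> R6"
    using extend3[OF R5, of "k + 4" k] z6 by (auto simp: vals k)
  have "\<theta> \<circ> \<rho> \<circ> \<theta> \<circ> \<theta> \<circ> \<rho> \<circ> \<theta> = id"
  proof
    fix i
    consider "i < k \<or> k + 4 < i" | "i = k" | "i = k + 1" | "i = k + 2" | "i = k + 3" | "i = k + 4"
      by linarith
    then show "(\<theta> \<circ> \<rho> \<circ> \<theta> \<circ> \<theta> \<circ> \<rho> \<circ> \<theta>) i = id i"
      by cases (simp_all only: comp_apply \<theta> \<rho> id_apply)
  qed
  \<comment> \<open>Insert the relation in front of \<open>tau (m - 2)\<close> and absorb its last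
    factor by \<open>\<theta> \<circ> tau (m - 2) = tau (m + 2)\<close>.\<close>
  then have "w = \<theta> \<circ> \<rho> \<circ> \<theta> \<circ> \<theta> \<circ> \<rho> \<circ> tau (m + 2)"
    unfolding w_def using rot5_tau[OF assms(3), folded \<theta>_def] by (metis comp_assoc)
  moreover have "{(k + 4, k), (k, k + 3), (k + 3, k + 1), (k + 1, k + 2), (k + 2, k + 3), (k + 3, k + 4)} = ?T"
    by auto
  ultimately have "\<exists>R. grown m ?T R"
    using R6 chain_close assms(2) by metis
  then show ?thesis by (simp add: k numeral_eq_Suc)
qed

text \<open>With \<open>\<rho> = rot3 m\<close>, the vertices \<open>x\<close>,
  \<open>x \<circ> \<rho>\<close>, \<open>x \<circ> \<rho> \<circ> \<rho>\<close> lie in the blocks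
  \<open>(p, q)\<close>, \<open>(r, p)\<close>, \<open>(q, r)\<close>. Replacing their arcs of index
  \<open>m\<close> by arcs of index \<open>m + 2\<close> permutes the three successors cyclically,
  which merges the two fresh cycles into the old one.\<close>

lemma grown_triangle:
  assumes "good m R0" "odd m" "5 \<le> m" "grown m S R"
    and "(p, q) \<in> S" "r \<in> {1..m + 2} - {p, q}" "(q, r) \<notin> S" "(r, p) \<notin> S"
  shows "\<exists>R. grown m (insert (q, r) (insert (r, p) S)) R"
proof -
  have m3: "3 \<le> m" using assms(3) by simp
  let ?T = "insert (q, r) (insert (r, p) S)"
  define \<rho> where "\<rho> = rot3 m"
  have alt: "\<rho> \<in> alt (m + 2)" unfolding \<rho>_def using rot3_in_alt assms by auto
  note extend3 = chain_extend[OF assms(1,2) m3 _ rot3_tau[OF m3, folded \<rho>_def] disjI1[OF refl]]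
  have "avail m S S R" using assms(4) by (simp add: grown_def)
  from this[unfolded avail_def, rule_format, OF assms(5,6,7,8)]
  obtain x where x: "x \<in> block m (p, q)" "x m = r" "(x, x \<circ> tau m) \<in> R" by auto
  obtain R1 where R1: "chain m S ?T R1 (x \<circ> tau m) x"
    using chain_open[OF assms(4) x(3,1), of ?T] x(2) by auto
  have x1: "x \<circ> \<rho> \<in> block m (r, p)" "(x \<circ> \<rho>) m = q"
    using x alt alt_comp[of x "m + 2" \<rho>] by (auto simp: block_def \<rho>_def rot3_def)
  then obtain R2 where R2: "chain m (insert (r, p) S) ?T R2 (x \<circ> tau m) (x \<circ> \<rho>)"
    using extend3[OF R1 x1(1) assms(8)] assms(5) by auto
  have x2: "x \<circ> \<rho> \<circ> \<rho> \<in> block m (q, r)" "(x \<circ> \<rho> \<circ> \<rho>) m = p"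
    using x x1 alt alt_comp[of "x \<circ> \<rho>" "m + 2" \<rho>] by (auto simp: block_def \<rho>_def rot3_def)
  have "(q, r) \<notin> insert (r, p) S" using assms by auto
  then obtain R3 where R3: "chain m ?T ?T R3 (x \<circ> tau m) (x \<circ> \<rho> \<circ> \<rho>)" "\<exists>u. (u, u \<circ> tau m) \<in> R3"
    using extend3[OF R2 x2(1)] x2(2) assms(5) by auto
  \<comment> \<open>Since \<open>\<rho>\<close> has order three, the jump of index
    \<open>m + 2\<close> from the third vertex hits the successor that \<open>x\<close>
    lost.\<close>
  have "\<rho> \<circ> \<rho> \<circ> \<rho> = id" by (auto simp: \<rho>_def rot3_def fun_eq_iff)
  then have "x \<circ> \<rho> \<circ> \<rho> \<circ> tau (m + 2) = x \<circ> tau m"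
    using rot3_tau[OF m3, folded \<rho>_def] by (metis comp_assoc comp_id)
  with R3 show ?thesis using chain_close assms(2) by metis
qed

lemma reach_grown:
  assumes "reach m S" "good m R0" "odd m" "5 \<le> m"
  shows "\<exists>R. grown m S R"
  using assms(1)
proof (induction rule: reach.induct)
  case bowtie
  show ?case using grown_bowtie assms by blast
next
  case (triangle S p q r)
  then show ?case using grown_triangle[OF assms(2-4)] by metis
qed

section \<open>Exhausting the complete digraph by directed triangles\<close>

lemma reach_complete5:
  assumes "5 \<le> m"
  shows "reach m {(p, q). p \<in> {m - 2..m + 2} \<and> q \<in> {m - 2..m + 2} \<and> p \<noteq> q}"
proof -
  define k where "k = m - 2"
  have k: "m = k + 2" using assms by (simp add: k_def)
  have k1: "1 \<le> k" using assms k by simp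
  have "reach m {(k + 3, k + 4), (k + 2, k + 3), (k + 1, k + 2), (k + 3, k + 1), (k, k + 3), (k + 4, k)}"
    using reach.bowtie[of m] by (simp add: k numeral_eq_Suc)
  \<comment> \<open>Seven triangles, each with exactly one side already present, add 14 arcs to the
    six of the bow-tie and give all 20 arcs on five vertices.\<close>
  from reach.triangle[OF this, of "k + 1" "k + 2" "k + 4"]
  have "reach m
    {(k + 2, k + 4), (k + 4, k + 1), (k + 3, k + 4), (k + 2, k + 3), (k + 1, k + 2), (k + 3, k + 1), (k, k + 3), (k + 4, k)}"
    using k1 by (simp add: k)
  from reach.triangle[OF this, of "k + 1" "k + 2" "k"]
  have "reach m
    {(k + 2, k), (k, k + 1), (k + 2, k + 4), (k + 4, k + 1), (k + 3, k + 4), (k + 2, k + 3), (k + 1, k + 2), (k + 3, k + 1), (k, k + 3), (k + 4, k)}"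
    using k1 by (simp add: k)
  from reach.triangle[OF this, of "k + 2" "k + 3" "k"]
  have "reach m
    {(k + 3, k), (k, k + 2), (k + 2, k), (k, k + 1), (k + 2, k + 4), (k + 4, k + 1), (k + 3, k + 4), (k + 2, k + 3), (k + 1, k + 2), (k + 3, k + 1), (k, k + 3), (k + 4, k)}"
    using k1 by (simp add: k)
  from reach.triangle[OF this, of "k + 2" "k + 4" "k + 3"]
  have "reach m
    {(k + 4, k + 3), (k + 3, k + 2), (k + 3, k), (k, k + 2), (k + 2, k), (k, k + 1), (k + 2, k + 4), (k + 4, k + 1), (k + 3, k + 4), (k + 2, k + 3), (k + 1, k + 2), (k + 3, k + 1), (k, k + 3), (k + 4, k)}"
    using k1 by (simp add: k)
  from reach.triangle[OF this, of "k + 3" "k + 2" "k + 1"]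
  have "reach m
    {(k + 2, k + 1), (k + 1, k + 3), (k + 4, k + 3), (k + 3, k + 2), (k + 3, k), (k, k + 2), (k + 2, k), (k, k + 1), (k + 2, k + 4), (k + 4, k + 1), (k + 3, k + 4), (k + 2, k + 3), (k + 1, k + 2), (k + 3, k + 1), (k, k + 3), (k + 4, k)}"
    using k1 by (simp add: k)
  from reach.triangle[OF this, of "k + 2" "k + 1" "k + 4"]
  have "reach m
    {(k + 1, k + 4), (k + 4, k + 2), (k + 2, k + 1), (k + 1, k + 3), (k + 4, k + 3), (k + 3, k + 2), (k + 3, k), (k, k + 2), (k + 2, k), (k, k + 1), (k + 2, k + 4), (k + 4, k + 1), (k + 3, k + 4), (k + 2, k + 3), (k + 1, k + 2), (k + 3, k + 1), (k, k + 3), (k + 4, k)}"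
    using k1 by (simp add: k)
  from reach.triangle[OF this, of "k + 4" "k + 1" "k"]
  have "reach m
    {(k + 1, k), (k, k + 4), (k + 1, k + 4), (k + 4, k + 2), (k + 2, k + 1), (k + 1, k + 3), (k + 4, k + 3), (k + 3, k + 2), (k + 3, k), (k, k + 2), (k + 2, k), (k, k + 1), (k + 2, k + 4), (k + 4, k + 1), (k + 3, k + 4), (k + 2, k + 3), (k + 1, k + 2), (k + 3, k + 1), (k, k + 3), (k + 4, k)}"
    using k1 by (simp add: k)
  moreover have "{k..k + 4} = {k, k + 1, k + 2, k + 3, k + 4}" by auto
  then have "{(k + 1, k), (k, k + 4), (k + 1, k + 4), (k + 4, k + 2), (k + 2, k + 1), (k + 1, k + 3), (k + 4, k + 3), (k + 3, k + 2), (k + 3, k), (k, k + 2), (k + 2, k), (k, k + 1), (k + 2, k + 4), (k + 4, k + 1), (k + 3, k + 4), (k + 2, k + 3), (k + 1, k + 2), (k + 3, k + 1), (k, k + 3), (k + 4, k)} =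
      {(p, q). p \<in> {k..k + 4} \<and> q \<in> {k..k + 4} \<and> p \<noteq> q}"
    by (simp only:) auto
  ultimately show ?thesis by (simp add: k numeral_eq_Suc)
qed

text \<open>Triangles with apex \<open>a\<close> are placed on the arcs of the directed cycle
  \<open>Suc a, ..., m + 2, Suc a\<close>; each adds one arc into \<open>a\<close> and one out of
  \<open>a\<close>.\<close>

lemma reach_add:
  assumes "reach m {(p, q). p \<in> {Suc a..m + 2} \<and> q \<in> {Suc a..m + 2} \<and> p \<noteq> q}"
    "1 \<le> a" "a + 2 \<le> m + 2"
  shows "reach m {(p, q). p \<in> {a..m + 2} \<and> q \<in> {a..m + 2} \<and> p \<noteq> q}"
proof -
  let ?V = "\<lambda>a. {(p, q). p \<in> {a..m + 2} \<and> q \<in> {a..m + 2} \<and> p \<noteq> q}"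
  \<comment> \<open>State after the arcs from \<open>Suc a\<close> up to \<open>b\<close>: the arcs
    out of \<open>a\<close> lag one behind those into \<open>a\<close>, and the arc from
    \<open>Suc a\<close> into \<open>a\<close> waits for the final triangle on
    \<open>(m + 2, Suc a)\<close>.\<close>
  have "reach m (?V (Suc a) \<union> {(a, q) | q. Suc a \<le> q \<and> q < b} \<union> {(q, a) | q. Suc a < q \<and> q \<le> b})"
    if "Suc a \<le> b" "b \<le> m + 2" for b
    using that
  proof (induction b rule: dec_induct)
    case base
    have "?V (Suc a) \<union> {(a, q) | q. Suc a \<le> q \<and> q < Suc a} \<union> {(q, a) | q. Suc a < q \<and> q \<le> Suc a} = ?V (Suc a)"
      by auto
    then show ?case using assms(1) by simp
  next
    case (step b)
    let ?S = "?V (Suc a) \<union> {(a, q) | q. Suc a \<le> q \<and> q < b} \<union> {(q, a) | q. Suc a < q \<and> q \<le> b}"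
    have "reach m (insert (Suc b, a) (insert (a, b) ?S))"
      using step assms(2,3) by (intro reach.triangle[of m ?S b "Suc b" a]) auto
    moreover have "insert (Suc b, a) (insert (a, b) ?S) =
        ?V (Suc a) \<union> {(a, q) | q. Suc a \<le> q \<and> q < Suc b} \<union> {(q, a) | q. Suc a < q \<and> q \<le> Suc b}"
      using step by (auto simp: less_Suc_eq le_Suc_eq)
    ultimately show ?case by simp
  qed
  from this[of "m + 2"] have
    "reach m (?V (Suc a) \<union> {(a, q) | q. Suc a \<le> q \<and> q < m + 2} \<union> {(q, a) | q. Suc a < q \<and> q \<le> m + 2})"
    (is "reach m ?S")
    using assms by simp
  then have "reach m (insert (Suc a, a) (insert (a, m + 2) ?S))"
    using assms(2,3) by (intro reach.triangle[of m ?S "m + 2" "Suc a" a]) auto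
  moreover have "insert (Suc a, a) (insert (a, m + 2) ?S) = ?V a"
  proof -
    have "?V a = ?V (Suc a) \<union> {(a, q) | q. Suc a \<le> q \<and> q \<le> m + 2} \<union> {(q, a) | q. Suc a \<le> q \<and> q \<le> m + 2}"
      using assms(3) by (auto simp: Suc_le_eq order_le_less)
    also have "\<dots> = insert (Suc a, a) (insert (a, m + 2) ?S)"
      using assms(3) by (auto simp: order_le_less Suc_le_eq)
    finally show ?thesis by simp
  qed
  ultimately show ?thesis by simp
qed

lemma reach_complete:
  assumes "5 \<le> m"
  shows "reach m {(p, q). p \<in> {1..m + 2} \<and> q \<in> {1..m + 2} \<and> p \<noteq> q}"
proof -
  \<comment> \<open>\<open>k\<close> counts the vertices added below the initial five.\<close>
  have *: "reach m {(p, q). p \<in> {m - 2 - k..m + 2} \<and> q \<in> {m - 2 - k..m + 2} \<and> p \<noteq> q}"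
    if "k < m - 2" for k
    using that
  proof (induction k)
    case 0
    then show ?case using reach_complete5[OF assms] by simp
  next
    case (Suc k)
    have eq: "m - 2 - k = Suc (m - 2 - Suc k)" using Suc.prems by simp
    have "reach m {(p, q). p \<in> {m - 2 - k..m + 2} \<and> q \<in> {m - 2 - k..m + 2} \<and> p \<noteq> q}"
      using Suc.IH Suc.prems by simp
    from reach_add[OF this[unfolded eq]] show ?case using Suc.prems by simp
  qed
  have "m - 3 < m - 2" "m - 2 - (m - 3) = 1" using assms by auto
  then show ?thesis using *[of "m - 3"] by metis
qed

lemma good_step:
  assumes "good m R" "odd m" "5 \<le> m"
  shows "\<exists>R. good (m + 2) R"
proof -
  let ?S = "{(p, q). p \<in> {1..m + 2} \<and> q \<in> {1..m + 2} \<and> p \<noteq> q}"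
  obtain R' where R': "cycle_on (\<Union> (block m ` ?S)) R'" "R' \<subseteq> jumps (m + 2)"
     "\<exists>u. (u, u \<circ> tau m) \<in> R'" "\<And>c. c \<in> ?S \<Longrightarrow> \<exists>x\<in>block m c. (x, x \<circ> tau (m + 2)) \<in> R'"
    using reach_grown[OF reach_complete[OF assms(3)] assms] unfolding grown_def by auto
  have "\<Union> (block m ` ?S) = alt (m + 2)"
  proof (intro subset_antisym subsetI)
    fix x assume x: "x \<in> alt (m + 2)"
    then have p: "x permutes {1..m + 2}" by (simp add: alt_group_carrier)
    have "x (m + 1) \<in> {1..m + 2}" "x (m + 2) \<in> {1..m + 2}" "x (m + 1) \<noteq> x (m + 2)"
      using permutes_in_image[OF p] inj_eq[OF alt_inj[OF x]] by auto
    then have "(x (m + 1), x (m + 2)) \<in> ?S" by blast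
    moreover have "x \<in> block m (x (m + 1), x (m + 2))" using x by (simp add: block_def)
    ultimately show "x \<in> \<Union> (block m ` ?S)" by (rule UN_I)
  qed (auto simp: block_def)
  moreover have "\<exists>x. x (m + 2) = r \<and> (x, x \<circ> tau (m + 2)) \<in> R'" if "r \<in> {1..m + 2}" for r
  proof -
    \<comment> \<open>Any block with second coordinate \<open>r\<close> will do, since each block
      emits an arc of index \<open>m + 2\<close>.\<close>
    obtain p where "p \<in> {1..m + 2}" "p \<noteq> r"
      using assms(3) by (intro that[of "if r = 1 then 2 else 1"]) auto
    then show ?thesis using R'(4)[of "(p, r)"] that unfolding block_def by auto
  qed
  ultimately show ?thesis using R' unfolding good_def by (intro exI[of _ R']) auto
qed

subsection \<open>Seven letters\<close>

text \<open>A three-element type and explicit seven-letter patterns let \<open>code_simp\<close>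
  follow the word by pattern rewriting, without arithmetic on positions.\<close>

datatype gen = T3 | T5 | T7

primrec gen_index :: "gen \<Rightarrow> nat" where
  "gen_index T3 = 3" | "gen_index T5 = 5" | "gen_index T7 = 7"

fun step :: "gen \<Rightarrow> nat list \<Rightarrow> nat list" where
  "step T3 [a, b, c, d, e, f, g] = [c, a, b, d, e, f, g]"
| "step T5 [a, b, c, d, e, f, g] = [e, a, b, c, d, f, g]"
| "step T7 [a, b, c, d, e, f, g] = [g, a, b, c, d, e, f]"
| "step _ l = l"

primrec trace :: "nat list \<Rightarrow> gen list \<Rightarrow> nat list list" where
  "trace l [] = []"
| "trace l (k # ks) = l # trace (step k l) ks"

fun ends :: "nat \<Rightarrow> nat \<Rightarrow> nat list \<Rightarrow> bool" where
  "ends x y [a, b, c, d, e, f, g] \<longleftrightarrow> f = x \<and> g = y"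
| "ends x y _ \<longleftrightarrow> False"

primrec cons_if :: "bool \<Rightarrow> 'a \<Rightarrow> 'a list \<Rightarrow> 'a list" where
  "cons_if True x xs = x # xs"
| "cons_if False x xs = xs"

primrec visits :: "nat \<Rightarrow> nat \<Rightarrow> nat list \<Rightarrow> gen list \<Rightarrow> nat list list" where
  "visits x y l [] = []"
| "visits x y l (k # ks) = cons_if (ends x y l) l (visits x y (step k l) ks)"

primrec visits_from :: "nat \<Rightarrow> nat \<Rightarrow> nat list list \<Rightarrow> gen list \<Rightarrow> nat list list" where
  "visits_from x y [] w = []"
| "visits_from x y (l # ls) w = visits x y l w @ visits_from x y ls w"

primrec distinct_visits :: "(nat \<times> nat) list \<Rightarrow> nat list list \<Rightarrow> gen list \<Rightarrow> bool" where
  "distinct_visits [] ls w \<longleftrightarrow> True"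
| "distinct_visits (c # cs) ls w \<longleftrightarrow>
     distinct (visits_from (fst c) (snd c) ls w) \<and> distinct_visits cs ls w"

lemma visits_eq_filter: "visits x y l w = filter (ends x y) (trace l w)"
proof (induction w arbitrary: l)
  case (Cons k ks)
  then show ?case by (cases "ends x y l") auto
qed simp

lemma visits_from_eq_filter:
  "visits_from x y ls w = filter (ends x y) (concat (map (\<lambda>l. trace l w) ls))"
  by (induction ls) (auto simp: visits_eq_filter)

lemma distinct_visitsD:
  "distinct_visits cs ls w \<Longrightarrow> (x, y) \<in> set cs \<Longrightarrow>
     distinct (filter (ends x y) (concat (map (\<lambda>l. trace l w) ls)))"
  by (induction cs) (auto simp: visits_from_eq_filter)

text \<open>Two equal entries satisfy a common \<open>P c\<close> and would repeat inside one
  filtered list.\<close>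

lemma distinct_if_distinct_filter:
  assumes "\<And>l. l \<in> set ls \<Longrightarrow> \<exists>c\<in>C. P c l" "\<And>c. c \<in> C \<Longrightarrow> distinct (filter (P c) ls)"
  shows "distinct ls"
  using assms
proof (induction ls)
  case (Cons l ls)
  have "distinct (filter (P c) ls)" if "c \<in> C" for c
    using Cons.prems(2)[OF that] by (auto split: if_splits)
  then have "distinct ls" using Cons.IH Cons.prems(1) by auto
  moreover obtain c where "c \<in> C" "P c l" using Cons.prems(1)[of l] by auto
  then have "l \<notin> set ls" using Cons.prems(2)[of c] by auto
  ultimately show ?case by simp
qed simp

section \<open>Lists of seven letters as permutations\<close>

definition perm_of :: "nat list \<Rightarrow> nat \<Rightarrow> nat" where
  "perm_of l i = (if 1 \<le> i \<and> i \<le> 7 then l ! (i - 1) else i)"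

lemma length_7E:
  assumes "length l = 7"
  obtains a b c d e f g where "l = [a, b, c, d, e, f, g]"
  using assms by (auto simp: length_Suc_conv numeral_eq_Suc)

lemma length_step: "length l = 7 \<Longrightarrow> length (step k l) = 7"
  by (elim length_7E) (cases k; simp)

lemma nat_le_7_cases:
  "i = 0 \<or> i = 1 \<or> i = 2 \<or> i = 3 \<or> i = 4 \<or> i = 5 \<or> i = 6 \<or> i = 7 \<or> 7 < (i :: nat)"
  by linarith

text \<open>Composition on the right rearranges positions in one-line notation, whatever the letters
  are.\<close>

lemma perm_of_step:
  assumes "length l = 7"
  shows "perm_of (step k l) = perm_of l \<circ> tau (gen_index k)"
proof
  fix i
  obtain a b c d e f g where l: "l = [a, b, c, d, e, f, g]" using assms by (rule length_7E)
  show "perm_of (step k l) i = (perm_of l \<circ> tau (gen_index k)) i"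
    using nat_le_7_cases[of i] unfolding l
    by (cases k) (auto simp: perm_of_def tau_def nth_Cons' numeral_eq_Suc)
qed

lemma perm_of_inj: "inj_on perm_of {l. length l = 7}"
proof (rule inj_onI)
  fix l l' assume "l \<in> {l. length l = 7}" "l' \<in> {l. length l = 7}" and eq: "perm_of l = perm_of l'"
  then have "length l = 7" "length l' = 7" by auto
  moreover have "l ! i = l' ! i" if "i < 7" for i
    using fun_cong[OF eq, of "Suc i"] that by (simp add: perm_of_def)
  ultimately show "l = l'" by (simp add: nth_equalityI)
qed

lemma trace_append: "trace l (v @ w) = trace l v @ trace (fold step v l) w"
  by (induction v arbitrary: l) auto

lemma length_trace: "length (trace l w) = length w"
  by (induction w arbitrary: l) auto

lemma trace_alt:
  assumes "length l = 7" "perm_of l \<in> alt 7" "l' \<in> set (trace l w)"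
  shows "length l' = 7 \<and> perm_of l' \<in> alt 7"
  using assms
proof (induction w arbitrary: l)
  case (Cons k ks)
  have "tau (gen_index k) \<in> alt 7" by (cases k) (auto intro: tau_in_alt_group)
  then have "perm_of (step k l) \<in> alt 7"
    unfolding perm_of_step[OF Cons.prems(1)] using Cons.prems(2) by (rule alt_comp[rotated])
  from Cons.IH[OF length_step[OF Cons.prems(1)] this] show ?case
    using Cons.prems by (cases "l' = l") auto
qed simp

text \<open>The arc to \<open>fold step w l\<close> is included so that every generator of
  \<open>w\<close> accounts for one arc; it is the closing arc when \<open>w\<close> leads back to
  \<open>l\<close>.\<close>

lemma path_arcs_trace:
  assumes "w \<noteq> []" "length l = 7"
  shows "insert (perm_of (last (trace l w)), perm_of (fold step w l)) (path_arcs (map perm_of (trace l w))) =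
    (\<lambda>(l, k). (perm_of l, perm_of l \<circ> tau (gen_index k))) ` set (zip (trace l w) w)"
  using assms
proof (induction w arbitrary: l rule: induct_list012)
  case (2 k)
  then show ?case by (simp add: path_arcs_def perm_of_step)
next
  case (3 k k' ks)
  let ?w = "k' # ks" and ?l = "step k l"
  have "insert (perm_of (last (trace ?l ?w)), perm_of (fold step ?w ?l)) (path_arcs (map perm_of (trace ?l ?w))) =
      (\<lambda>(l, k). (perm_of l, perm_of l \<circ> tau (gen_index k))) ` set (zip (trace ?l ?w) ?w)"
    by (rule "3.IH"(2)) (simp_all add: length_step "3.prems"(2))
  moreover have "path_arcs (map perm_of (trace l (k # ?w))) =
      insert (perm_of l, perm_of ?l) (path_arcs (map perm_of (trace ?l ?w)))"
    by (simp add: path_arcs_def)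
  moreover have "last (trace l (k # ?w)) = last (trace ?l ?w)" by simp
  moreover have "zip (trace l (k # ?w)) (k # ?w) = (l, k) # zip (trace ?l ?w) ?w" by simp
  moreover have "fold step (k # ?w) l = fold step ?w ?l" by simp
  ultimately show ?case
    by (simp only: list.set image_insert prod.case perm_of_step[OF "3.prems"(2)] insert_commute)
qed simp

text \<open>Found by a randomised search among the cycles invariant under the relabelling
  \<open>1 \<rightarrow> 2 \<rightarrow> 3 \<rightarrow> 4 \<rightarrow> 5 \<rightarrow> 1\<close>: five repetitions of the word form a Hamiltonian cycle. Its 2520
  vertices are compared only within the groups that share the last two letters.\<close>

definition word7 :: "gen list" where
  "word7 = [T7, T7, T7, T7, T7, T3, T5, T3, T3, T7, T5, T7, T7, T7, T7, T3, T5, T7, T7, T5, T3, T7, T3, T7,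
    T5, T7, T7, T3, T7, T7, T3, T7, T3, T7, T3, T7, T3, T7, T3, T7, T7, T5, T3, T7, T5, T3, T5, T5,
    T5, T7, T7, T3, T7, T5, T7, T7, T7, T5, T3, T5, T5, T7, T3, T5, T7, T7, T7, T7, T7, T3, T7, T7,
    T7, T7, T7, T5, T3, T7, T5, T7, T7, T5, T3, T3, T7, T7, T7, T3, T7, T7, T5, T5, T3, T7, T5, T3,
    T5, T3, T7, T3, T7, T7, T3, T5, T7, T7, T7, T7, T5, T7, T7, T5, T7, T5, T3, T7, T7, T5, T3, T5,
    T7, T7, T5, T7, T5, T5, T7, T7, T7, T5, T3, T7, T5, T7, T3, T3, T7, T3, T7, T3, T3, T7, T5, T5,
    T7, T7, T3, T7, T7, T7, T3, T5, T7, T5, T5, T7, T7, T5, T5, T7, T5, T5, T3, T7, T5, T5, T5, T3,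
    T7, T5, T3, T7, T7, T7, T5, T7, T7, T7, T7, T5, T7, T5, T3, T7, T5, T5, T7, T7, T7, T3, T3, T5,
    T7, T5, T3, T3, T7, T7, T5, T5, T7, T3, T7, T3, T5, T7, T5, T5, T7, T7, T5, T3, T3, T5, T5, T5,
    T7, T3, T7, T7, T5, T3, T7, T3, T7, T3, T7, T3, T7, T5, T3, T3, T7, T3, T3, T5, T7, T7, T3, T3,
    T5, T7, T7, T5, T5, T7, T7, T7, T7, T3, T7, T7, T3, T3, T7, T7, T7, T7, T3, T7, T3, T7, T5, T7,
    T5, T3, T7, T7, T7, T7, T5, T5, T5, T7, T7, T3, T3, T5, T5, T7, T7, T5, T7, T7, T5, T3, T7, T3,
    T7, T5, T7, T7, T3, T7, T5, T7, T7, T7, T5, T3, T7, T5, T5, T7, T3, T3, T5, T7, T7, T5, T7, T7,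
    T5, T7, T7, T7, T5, T5, T7, T5, T3, T3, T5, T5, T7, T5, T7, T3, T7, T3, T7, T7, T7, T3, T5, T5,
    T7, T5, T7, T5, T5, T3, T7, T3, T7, T7, T5, T7, T5, T3, T7, T7, T3, T7, T7, T7, T5, T5, T5, T7,
    T7, T3, T7, T7, T7, T3, T7, T5, T5, T5, T3, T7, T5, T5, T7, T3, T3, T7, T5, T7, T3, T5, T5, T3,
    T5, T7, T5, T5, T7, T7, T7, T5, T7, T5, T3, T7, T7, T3, T7, T5, T7, T3, T5, T7, T7, T7, T7, T5,
    T7, T5, T5, T7, T7, T5, T5, T5, T7, T7, T3, T7, T3, T3, T7, T7, T7, T7, T3, T7, T5, T7, T7, T5,
    T5, T3, T7, T5, T7, T7, T7, T7, T7, T7, T3, T7, T5, T7, T3, T5, T7, T7, T5, T5, T5, T5, T7, T3,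
    T5, T3, T7, T7, T7, T7, T7, T5, T7, T3, T7, T3, T7, T7, T7, T7, T7, T5, T7, T7, T7, T7, T3, T5,
    T5, T3, T7, T3, T3, T7, T7, T3, T5, T5, T3, T7, T5, T7, T5, T7, T7, T7, T3, T7, T7, T5, T7, T3]"

text \<open>The lists at which the successive repetitions of \<open>word7\<close> begin, as
  \<open>fold_word7\<close> confirms.\<close>

definition starts :: "nat list list" where
  "starts = [[1, 2, 3, 4, 5, 6, 7], [2, 3, 4, 5, 1, 6, 7], [3, 4, 5, 1, 2, 6, 7],
     [4, 5, 1, 2, 3, 6, 7], [5, 1, 2, 3, 4, 6, 7]]"

definition suffixes :: "(nat \<times> nat) list" where
  "suffixes = filter (\<lambda>(x, y). x \<noteq> y) (List.product [1..<8] [1..<8])"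

lemma distinct_visits_word7: "distinct_visits suffixes starts word7"
  by code_simp

lemma length_word7: "length word7 = 504"
  by code_simp

lemma fold_word7:
  "fold step word7 [1, 2, 3, 4, 5, 6, 7] = [2, 3, 4, 5, 1, 6, 7]"
  "fold step word7 [2, 3, 4, 5, 1, 6, 7] = [3, 4, 5, 1, 2, 6, 7]"
  "fold step word7 [3, 4, 5, 1, 2, 6, 7] = [4, 5, 1, 2, 3, 6, 7]"
  "fold step word7 [4, 5, 1, 2, 3, 6, 7] = [5, 1, 2, 3, 4, 6, 7]"
  "fold step word7 [5, 1, 2, 3, 4, 6, 7] = [1, 2, 3, 4, 5, 6, 7]"
  by code_simp+

text \<open>At the first three jumps the last letters are the seventh, sixth and fifth of the
  starting list. Over the five starts the fifth letter runs through 1 to 5, so every letter is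
  jumped to the front by \<open>T7\<close>.\<close>

lemma word7_prefix: "\<exists>w. word7 = T7 # T7 # T7 # w" and T5_in_word7: "T5 \<in> set word7"
  by (simp_all add: word7_def)

text \<open>The trace stays in \<open>alt 7\<close> and is distinct, and its length 2520 is the
  order of that group; so it is Hamiltonian by counting.\<close>

lemma good_7: "\<exists>R. good 7 R"
proof -
  let ?u = word7 and ?l = "[1, 2, 3, 4, 5, 6, 7] :: nat list"
  define w where "w = ?u @ ?u @ ?u @ ?u @ ?u"
  define f where "f = (\<lambda>(l, k). (perm_of l, perm_of l \<circ> tau (gen_index k)))"
  let ?R = "f ` set (zip (trace ?l w) w)" and ?p = "map perm_of (trace ?l w)"
  have tr: "trace ?l w = concat (map (\<lambda>l. trace l ?u) starts)"
    by (simp add: w_def trace_append fold_word7 starts_def del: One_nat_def)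
  have w: "w \<noteq> []" "length w = 2520" using length_word7 by (auto simp: w_def)
  have "perm_of ?l = id"
  proof
    fix i show "perm_of ?l i = id i"
      using nat_le_7_cases[of i] by (auto simp: perm_of_def)
  qed
  then have l: "length ?l = 7" "perm_of ?l \<in> alt 7"
    by (simp_all add: alt_group_carrier permutes_id evenperm_id)
  note alt = trace_alt[OF l]
  have suffix: "\<exists>c\<in>set suffixes. ends (fst c) (snd c) l'" if l': "l' \<in> set (trace ?l w)" for l'
  proof -
    obtain a b c d e x y where eq: "l' = [a, b, c, d, e, x, y]"
      using alt[OF l'] by (auto elim: length_7E)
    have p: "perm_of l' permutes {1..7}" and "inj (perm_of l')"
      using alt[OF l'] alt_inj by (auto simp: alt_group_carrier)
    then have "perm_of l' 6 \<in> {1..7}" "perm_of l' 7 \<in> {1..7}" "perm_of l' 6 \<noteq> perm_of l' 7"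
      using permutes_in_image[OF p] by (auto simp: inj_eq)
    then have "x \<in> {1..7}" "y \<in> {1..7}" "x \<noteq> y" by (auto simp: perm_of_def eq)
    then have "(x, y) \<in> set suffixes" by (auto simp: suffixes_def)
    then show ?thesis by (rule bexI[rotated]) (simp add: eq)
  qed
  have "distinct (filter (ends (fst c) (snd c)) (trace ?l w))" if "c \<in> set suffixes" for c
    using distinct_visitsD[OF distinct_visits_word7, of "fst c" "snd c"] that
    unfolding tr by simp
  from distinct_if_distinct_filter[where P = "\<lambda>c. ends (fst c) (snd c)", OF suffix this]
  have "distinct (trace ?l w)" .
  moreover have "inj_on perm_of (set (trace ?l w))"
    using alt by (intro inj_on_subset[OF perm_of_inj]) auto
  ultimately have dist: "distinct ?p" by (simp add: distinct_map)
  have sub: "set ?p \<subseteq> alt 7" using alt by auto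
  have card7: "card (alt 7) = 2520"
    using alt_group_card_carrier[of 7] by (simp add: fact_numeral)
  have p: "set ?p = alt 7"
  proof (rule card_subset_eq[OF _ sub])
    show "finite (alt 7)" using card7 card_eq_0_iff by fastforce
    show "card (set ?p) = card (alt 7)"
      using distinct_card[OF dist] w(2) by (simp add: length_trace card7)
  qed
  have ne: "trace ?l w \<noteq> []" using w(1) by (cases w) auto
  have "hd ?p = perm_of ?l" using w(1) by (cases w) auto
  moreover have "fold step w ?l = ?l" by (simp add: w_def fold_word7 del: One_nat_def)
  ultimately have "?R = insert (last ?p, hd ?p) (path_arcs ?p)"
    using path_arcs_trace[OF w(1) l(1)] last_map[OF ne, of perm_of] unfolding f_def by simp
  moreover have "path_on (alt 7) (path_arcs ?p) (hd ?p) (last ?p)"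
    unfolding path_on_def using ne dist p by (intro exI[of _ ?p] conjI refl) simp_all
  ultimately have cyc: "cycle_on (alt 7) ?R"
    unfolding cycle_on_def by (intro exI conjI)
  have arcI: "(perm_of l', perm_of l' \<circ> tau (gen_index k)) \<in> ?R" if "(l', k) \<in> set (zip (trace ?l w) w)" for l' k
    using imageI[OF that, of f] by (simp add: f_def)
  have "?R \<subseteq> jumps 7"
  proof (rule image_subsetI)
    fix a :: "nat list \<times> gen"
    obtain l' k where a: "a = (l', k)" by fastforce
    show "f a \<in> jumps 7"
      unfolding f_def a by (cases k) (auto intro: tau_in_jumps)
  qed
  moreover have "\<exists>x. x 7 = r \<and> (x, x \<circ> tau 7) \<in> ?R" if r: "r \<in> {1..7}" for r
  proof -
    have zips: "zip (trace ?l w) w = concat (map (\<lambda>l. zip (trace l ?u) ?u) starts)"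
      by (simp add: w_def trace_append fold_word7 starts_def length_trace del: One_nat_def)
    obtain u' where u': "?u = T7 # T7 # T7 # u'" using word7_prefix by blast
    have "(l', T7) \<in> set (zip (trace l' ?u) ?u)" "(step T7 l', T7) \<in> set (zip (trace l' ?u) ?u)"
      "(step T7 (step T7 l'), T7) \<in> set (zip (trace l' ?u) ?u)" for l'
      unfolding u' by simp_all
    then have hit: "(l', T7) \<in> set (zip (trace ?l w) w)" "(step T7 l', T7) \<in> set (zip (trace ?l w) w)"
      "(step T7 (step T7 l'), T7) \<in> set (zip (trace ?l w) w)" if "l' \<in> set starts" for l'
      unfolding zips using that by auto
    have "\<exists>a b c d e f. ([a, b, c, d, e, f, r], T7) \<in> set (zip (trace ?l w) w)"
    proof -
      have m: "[1, 2, 3, 4, 5, 6, 7] \<in> set starts" "[2, 3, 4, 5, 1, 6, 7] \<in> set starts"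
        "[3, 4, 5, 1, 2, 6, 7] \<in> set starts" "[4, 5, 1, 2, 3, 6, 7] \<in> set starts"
        "[5, 1, 2, 3, 4, 6, 7] \<in> set starts" by (simp_all add: starts_def)
      consider "r = 1" | "r = 2" | "r = 3" | "r = 4" | "r = 5" | "r = 6" | "r = 7"
        using nat_le_7_cases[of r] r by auto
      then show ?thesis
      proof cases
        case 1 then show ?thesis using hit(3)[OF m(2)] by simp blast
      next
        case 2 then show ?thesis using hit(3)[OF m(3)] by simp blast
      next
        case 3 then show ?thesis using hit(3)[OF m(4)] by simp blast
      next
        case 4 then show ?thesis using hit(3)[OF m(5)] by simp blast
      next
        case 5 then show ?thesis using hit(3)[OF m(1)] by simp blast
      next
        case 6 then show ?thesis using hit(2)[OF m(1)] by simp blast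
      next
        case 7 then show ?thesis using hit(1)[OF m(1)] by simp blast
      qed
    qed
    then obtain a b c d e f where "([a, b, c, d, e, f, r], T7) \<in> set (zip (trace ?l w) w)" by blast
    from arcI[OF this] show ?thesis
      by (intro exI[of _ "perm_of [a, b, c, d, e, f, r]"]) (auto simp: perm_of_def)
  qed
  moreover have "\<exists>x. (x, x \<circ> tau (7 - 2)) \<in> ?R"
  proof -
    have "T5 \<in> set w" using T5_in_word7 by (simp add: w_def)
    then obtain i where i: "i < length w" "w ! i = T5" by (auto simp: in_set_conv_nth)
    then have "(trace ?l w ! i, T5) \<in> set (zip (trace ?l w) w)"
      by (force simp: in_set_zip length_trace)
    from arcI[OF this] show ?thesis by auto
  qed
  ultimately show ?thesis using cyc unfolding good_def by blast
qed

subsection \<open>Snakes\<close>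

lemma strict_mono_permutes_eq_id:
  fixes \<sigma> :: "nat \<Rightarrow> nat"
  assumes "\<sigma> permutes {1..n}" "\<And>i j. 1 \<le> i \<Longrightarrow> i < j \<Longrightarrow> j \<le> n \<Longrightarrow> \<sigma> i < \<sigma> j"
  shows "\<sigma> = id"
proof (rule permutes_natset_ge[OF assms(1)], rule ballI)
  fix i assume "i \<in> {1..n}"
  then have "1 \<le> i" "i \<le> n" by auto
  then show "i \<le> \<sigma> i"
  proof (induction i rule: nat_induct_at_least)
    case base
    then have "\<sigma> 1 \<in> {1..n}" using permutes_in_image[OF assms(1), of 1] by simp
    then show ?case by simp
  next
    case (Suc i)
    then show ?case using assms(2)[of i "Suc i"] by simp
  qed
qed

text \<open>A position strictly between \<open>i\<close> and \<open>j\<close> would force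
  \<open>\<sigma> i < \<sigma> j\<close>, so the only inversion is between neighbours. Swapping
  these leaves an increasing permutation.\<close>

lemma inversion_number_1_imp_transpose:
  assumes "\<sigma> permutes {1..n}" "inversion_number n \<sigma> = 1"
  shows "\<exists>i. \<sigma> = Transposition.transpose i (Suc i)"
proof -
  let ?I = "{(i, j). 1 \<le> i \<and> i < j \<and> j \<le> n \<and> \<sigma> i > \<sigma> j}"
  obtain i j where I: "?I = {(i, j)}"
    using assms(2) unfolding inversion_number_def by (auto simp: card_1_singleton_iff)
  have inv: "1 \<le> a \<and> a < b \<and> b \<le> n \<and> \<sigma> a > \<sigma> b \<longleftrightarrow> a = i \<and> b = j" for a b
    using I by (auto simp: set_eq_iff)
  have ij: "1 \<le> i" "i < j" "j \<le> n" "\<sigma> i > \<sigma> j" using inv[of i j] by auto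
  have inj: "\<sigma> a \<noteq> \<sigma> b" if "a \<noteq> b" for a b
    using permutes_inj[OF assms(1)] that by (auto simp: inj_eq)
  have le: "\<sigma> a < \<sigma> b" if "1 \<le> a" "a < b" "b \<le> n" "(a, b) \<noteq> (i, j)" for a b
    using inv[of a b] inj[of a b] that by auto
  have j: "j = Suc i"
  proof (rule ccontr)
    assume "j \<noteq> Suc i"
    then have "\<sigma> i < \<sigma> (Suc i)" "\<sigma> (Suc i) < \<sigma> j" using ij le by auto
    then show False using ij by simp
  qed
  let ?t = "Transposition.transpose i (Suc i)"
  have "\<sigma> \<circ> ?t = id"
  proof (rule strict_mono_permutes_eq_id)
    have "?t permutes {1..n}" using ij j by (intro permutes_swap_id) auto
    then show "\<sigma> \<circ> ?t permutes {1..n}" using assms(1) by (rule permutes_compose)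
    fix a b assume ab: "1 \<le> a" "a < b" "b \<le> n"
    consider "a = i" "b = Suc i" | "a = i" "b \<noteq> Suc i" | "a = Suc i" | "b = i" | "b = Suc i" "a \<noteq> i"
      | "a \<notin> {i, Suc i}" "b \<notin> {i, Suc i}" by blast
    then show "(\<sigma> \<circ> ?t) a < (\<sigma> \<circ> ?t) b"
      by cases (use ab ij j le in \<open>auto simp: Transposition.transpose_def\<close>)
  qed
  then have "\<sigma> = ?t" by (metis comp_assoc comp_id id_comp transpose_comp_involutory)
  then show ?thesis by blast
qed

text \<open>Distance one would make the even permutation \<open>inv' x \<circ> y\<close> a
  transposition.\<close>

lemma kendall_tau_alt_neq_1:
  assumes "x \<in> alt n" "y \<in> alt n"
  shows "kendall_tau n x y \<noteq> 1"
proof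
  assume d: "kendall_tau n x y = 1"
  let ?s = "inv' x \<circ> y"
  have s: "?s \<in> alt n" using assms by (intro alt_comp alt_group_inv_closed)
  then obtain i where "?s = Transposition.transpose i (Suc i)"
    using d inversion_number_1_imp_transpose unfolding kendall_tau_def alt_group_carrier by blast
  then show False using s by (simp add: alt_group_carrier evenperm_swap)
qed

lemma inversion_number_transpose_1_2:
  assumes "2 \<le> n"
  shows "inversion_number n (Transposition.transpose 1 2) = 1"
proof -
  have "{(i, j). 1 \<le> i \<and> i < j \<and> j \<le> n \<and>
      Transposition.transpose 1 2 i > (Transposition.transpose 1 2 j :: nat)} = {(1, 2)}"
    using assms by (auto simp: Transposition.transpose_def split: if_splits)
  then show ?thesis by (simp add: inversion_number_def)
qed

text \<open>The vertex set and its right translate by the transposition of 1 and 2 are disjoint and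
  equally large inside the symmetric group.\<close>

lemma snake_length_le:
  assumes "2 \<le> n" "snake n c"
  shows "2 * length c \<le> fact n"
proof -
  let ?G = "sym_cayley n" and ?t = "Transposition.transpose 1 2 :: nat \<Rightarrow> nat"
  let ?V = "cycle_verts ?G c"
  have wf: "wf_digraph ?G"
    unfolding sym_cayley_def using sym_group_is_group group.is_monoid tau_in_sym_group
    by (intro wf_cayley_digraph) auto
  have tail: "tail ?G = fst" by (simp add: sym_cayley_def cayley_digraph_def)
  obtain u where u: "pre_digraph.awalk ?G u c u" "distinct (tl (pre_digraph.awalk_verts ?G u c))" "c \<noteq> []"
    using assms(2) unfolding snake_def pre_digraph.cycle_def by blast
  have cas: "pre_digraph.cas ?G u c u" and sub: "set c \<subseteq> arcs ?G"
    using u(1) unfolding pre_digraph.awalk_def by auto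
  have V: "?V \<subseteq> {p. p permutes {1..n}}"
    using sub tail by (auto simp: cycle_verts_def sym_cayley_def cayley_digraph_def sym_group_def)
  have len: "card ?V = length c"
  proof -
    \<comment> \<open>The vertex list read in two ways, as tails plus end point and as start plus
      heads. Hence the tails are the heads rotated by one place, and the distinctness of the heads
      in a cycle passes to the tails.\<close>
    have "pre_digraph.awalk_verts ?G u c = map (tail ?G) c @ [head ?G (last c)]"
      using u(3) by (simp add: pre_digraph.awalk_verts_conv)
    moreover have av: "pre_digraph.awalk_verts ?G u c = u # map (head ?G) c"
      using cas u(3) pre_digraph.awalk_verts_conv'[OF cas] by (cases c) (auto simp: pre_digraph.cas.simps)
    ultimately have tails: "map (tail ?G) c = u # butlast (map (head ?G) c)"
      using u(3) by (metis butlast.simps(2) butlast_snoc map_is_Nil_conv)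
    have "last (map (head ?G) c) = u"
      using wf_digraph.awlast_if_cas[OF wf cas] u(3) unfolding av by simp
    then have "map (head ?G) c = butlast (map (head ?G) c) @ [u]"
      using u(3) by (metis append_butlast_last_id map_is_Nil_conv)
    moreover have "distinct (map (head ?G) c)" using u(2) unfolding av by simp
    ultimately have "distinct (map (tail ?G) c)"
      unfolding tails by (metis distinct1_rotate rotate1.simps(2))
    then show ?thesis unfolding cycle_verts_def by (metis distinct_card length_map set_map)
  qed
  have t: "?t permutes {1..n}" using assms(1) by (intro permutes_swap_id) auto
  have "inj_on (\<lambda>x. x \<circ> ?t) ?V"
    by (intro inj_onI) (metis comp_assoc comp_id transpose_comp_involutory)
  then have "card ((\<lambda>x. x \<circ> ?t) ` ?V) = card ?V" by (rule card_image)
  \<comment> \<open>This is where the snake condition enters.\<close>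
  moreover have "?V \<inter> (\<lambda>x. x \<circ> ?t) ` ?V = {}"
  proof -
    have False if x: "x \<in> ?V" "x \<circ> ?t \<in> ?V" for x
    proof -
      have "inv' x \<circ> (x \<circ> ?t) = ?t"
        using x V permutes_inv_o(2)[of x "{1..n}"] by (auto simp: comp_assoc[symmetric])
      then have "kendall_tau n x (x \<circ> ?t) = 1"
        unfolding kendall_tau_def using inversion_number_transpose_1_2[OF assms(1)] by simp
      then show False using assms(2) x unfolding snake_def by blast
    qed
    then show ?thesis by blast
  qed
  moreover have fin: "finite {p :: nat \<Rightarrow> nat. p permutes {1..n}}" by (simp add: finite_permutations)
  moreover have "(\<lambda>x. x \<circ> ?t) ` ?V \<subseteq> {p. p permutes {1..n}}"
    using V t by (auto intro: permutes_compose)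
  ultimately have "2 * card ?V \<le> card {p :: nat \<Rightarrow> nat. p permutes {1..n}}"
    using V card_mono[OF fin, of "?V \<union> (\<lambda>x. x \<circ> ?t) ` ?V"] card_Un_disjoint[of ?V "(\<lambda>x. x \<circ> ?t) ` ?V"]
    by (auto dest: finite_subset)
  then show ?thesis using len by (simp add: card_permutations)
qed

lemma snake_alt_cycle:
  assumes "cycle_on (alt n) R" "R \<subseteq> jumps n" "2 \<le> n"
  shows "\<exists>c. hamiltonian_cycle (alt_cayley n) c" "\<exists>c. snake n c \<and> 2 * length c = fact n"
proof -
  have R: "R \<subseteq> alt n \<times> alt n" using assms(1) by (rule cycle_on_subset)
  have arcs: "R \<subseteq> arcs (alt_cayley n)"
    "R \<subseteq> arcs (sym_cayley n)"
  proof -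
    have "a \<in> arcs (alt_cayley n) \<and> a \<in> arcs (sym_cayley n)" if aR: "a \<in> R" for a
    proof -
      obtain x k where a: "a = (x, x \<circ> tau k)" "3 \<le> k" "k \<le> n" "odd k"
        using aR assms(2) unfolding jumps_def by blast
      moreover have "x \<in> alt n" "x \<in> carrier (sym_group n)"
        using R aR a by (auto simp: alt_group_carrier sym_group_carrier)
      ultimately show ?thesis
        unfolding alt_cayley_def sym_cayley_def cayley_digraph_def
        by (auto simp: alt_group_mult sym_group_mult)
    qed
    then show "R \<subseteq> arcs (alt_cayley n)" "R \<subseteq> arcs (sym_cayley n)" by auto
  qed
  show "\<exists>c. hamiltonian_cycle (alt_cayley n) c"
    using cycle_on_imp_cycle[OF assms(1) _ arcs(1)]
    by (auto simp: hamiltonian_cycle_def alt_cayley_def cayley_digraph_def)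
  have "alt n \<subseteq> verts (sym_cayley n)"
    by (auto simp: sym_cayley_def cayley_digraph_def alt_group_carrier sym_group_carrier)
  from cycle_on_imp_cycle[OF assms(1) this arcs(2)]
  obtain c where c: "pre_digraph.cycle (sym_cayley n) c" "cycle_verts (sym_cayley n) c = alt n"
    "length c = card (alt n)"
    by (auto simp: sym_cayley_def cayley_digraph_def)
  have "snake n c" unfolding snake_def c(2) using c(1) kendall_tau_alt_neq_1 by blast
  moreover have "2 * length c = fact n" using alt_group_card_carrier[OF assms(3)] c(3) by simp
  ultimately show "\<exists>c. snake n c \<and> 2 * length c = fact n" by blast
qed

lemma max_snake_length_eq:
  assumes "cycle_on (alt n) R" "R \<subseteq> jumps n" "2 \<le> n"
  shows "2 * max_snake_length n = fact n"
proof -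
  obtain c where c: "snake n c" "2 * length c = fact n" using snake_alt_cycle(2)[OF assms] by blast
  have "max_snake_length n = length c"
    unfolding max_snake_length_def
  proof (rule Max_eqI[OF finite_snake_lengths])
    show "length c \<in> {length c | c. snake n c}" using c(1) by blast
    fix l assume "l \<in> {length c | c. snake n c}"
    then obtain d where "l = length d" "snake n d" by blast
    then show "l \<le> length c" using snake_length_le[OF assms(3)] c(2) by fastforce
  qed
  then show ?thesis using c(2) by simp
qed

theorem theorem1:
  fixes n :: nat
  assumes "n \<ge> 7" and "odd n"
  shows "(\<exists>c. hamiltonian_cycle (alt_cayley n) c) \<and> real (max_snake_length n) = fact n / 2"
proof -
  have "\<exists>R. good (7 + 2 * j) R" for j
  proof (induction j)
    case 0
    then show ?case using good_7 by simp
  next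
    case (Suc j)
    then obtain R where "good (7 + 2 * j) R" by blast
    from good_step[OF this] show ?case by (simp add: algebra_simps)
  qed
  moreover have "even (n - 7)" using assms by simp
  then obtain j where "n - 7 = 2 * j" by (elim evenE)
  then have "n = 7 + 2 * j" using assms(1) by simp
  ultimately obtain R where "good n R" by blast
  then have R: "cycle_on (alt n) R" "R \<subseteq> jumps n" by (auto simp: good_def)
  have n2: "2 \<le> n" using assms(1) by simp
  \<comment> \<open>The doubled equation passes from naturals to reals without any rounding.\<close>
  have "real (2 * max_snake_length n) = real (fact n)"
    using max_snake_length_eq[OF R n2] by (simp only:)
  then have "real (max_snake_length n) = fact n / 2" by simp
  then show ?thesis using snake_alt_cycle(1)[OF R n2] by blast
qed

end
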